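(* Let $\mathbb{K}$ be a field, let $i_1, i_2 \geq 1$ be integers and let $\mathcal{L}$ be a finite lattice with minimal element $\hat{0}$ and with an element $m \in \mathcal{L}$ such that $\widetilde{H}_{i_1+i_2-2}\big((\hat{0},m)\big) \neq 0$. Then there exist elements $n_1, n_2 \in \mathcal{L}$ such that $\widetilde{H}_{i_1-2}\big((\hat{0},n_1)\big) \neq 0$, $\widetilde{H}_{i_2-2}\big((\hat{0},n_2)\big)\neq 0$ and $n_1 \vee n_2 = m$.
   Context: For elements $p \le q$ of a poset, $(p,q)$ denotes the open interval $\{x : p < x < q\}$. The homology $\widetilde{H}_*$ of a poset means the reduced simplicial homology, with coefficients in $\mathbb{K}$, of its order complex, i.e. the simplicial complex of its totally ordered subsets; in particular $\widetilde{H}_{-1}(\emptyset) = \mathbb{K}$. $n_1 \vee n_2$ denotes the supremum (join) in the lattice. *)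

theory Defs
  imports Main "HOL-Library.Poly_Mapping" "HOL-Algebra.Elementary_Groups"
begin

definition order_complex :: "'a::order set \<Rightarrow> 'a set set" where
  "order_complex P = {s. finite s \<and> s \<subseteq> P \<and> Complete_Partial_Order.chain (\<le>) s}"

text \<open>The empty simplex has dimension $-1$; this is what makes the homology below reduced.\<close>

definition simplices :: "'a::order set \<Rightarrow> int \<Rightarrow> 'a set set" where
  "simplices P k = {s \<in> order_complex P. int (card s) = k + 1}"

definition chain_space :: "'k itself \<Rightarrow> 'a::order set \<Rightarrow> int \<Rightarrow> ('a set \<Rightarrow>\<^sub>0 'k::field) set" where
  "chain_space _ P k = {c. Poly_Mapping.keys c \<subseteq> simplices P k}"

text \<open>Every simplex is oriented by the order of the poset: for $s = \{x_0 < \dots < x_k\}$ the face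
  omitting $x = x_i$ has sign $(-1)^i$, and \<^term>\<open>card {y \<in> s. y < x}\<close> is $i$. The face omitting
  the only vertex of a $0$-simplex is the empty simplex, so in degree $0$ this is the augmentation.\<close>

definition boundary :: "('a::order set \<Rightarrow>\<^sub>0 'k::field) \<Rightarrow> ('a set \<Rightarrow>\<^sub>0 'k)" where
  "boundary c = (\<Sum>s \<in> Poly_Mapping.keys c. \<Sum>x \<in> s.
     Poly_Mapping.single (s - {x}) ((- 1) ^ card {y \<in> s. y < x} * Poly_Mapping.lookup c s))"

definition cycles :: "'k itself \<Rightarrow> 'a::order set \<Rightarrow> int \<Rightarrow> ('a set \<Rightarrow>\<^sub>0 'k::field) set" where
  "cycles K P k = {c \<in> chain_space K P k. boundary c = 0}"

definition boundaries :: "'k itself \<Rightarrow> 'a::order set \<Rightarrow> int \<Rightarrow> ('a set \<Rightarrow>\<^sub>0 'k::field) set" where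
  "boundaries K P k = boundary ` chain_space K P (k + 1)"

definition cycle_group :: "'k itself \<Rightarrow> 'a::order set \<Rightarrow> int \<Rightarrow> ('a set \<Rightarrow>\<^sub>0 'k::field) monoid" where
  "cycle_group K P k = \<lparr>carrier = cycles K P k, monoid.mult = (+), one = 0\<rparr>"

text \<open>Only the additive group of the homology space is recorded, which is enough to say whether it
  vanishes.\<close>

definition reduced_homology ::
    "'k itself \<Rightarrow> int \<Rightarrow> 'a::order set \<Rightarrow> ('a set \<Rightarrow>\<^sub>0 'k::field) set monoid" where
  "reduced_homology K k P = cycle_group K P k Mod boundaries K P k"

lemma boundary_superset:
  assumes "finite S" "Poly_Mapping.keys c \<subseteq> S"
  shows "boundary c = (\<Sum>s \<in> S. \<Sum>x \<in> s.
     Poly_Mapping.single (s - {x}) ((- 1) ^ card {y \<in> s. y < x} * Poly_Mapping.lookup c s))"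
  unfolding boundary_def
  by (rule sum.mono_neutral_left) (use assms in \<open>auto simp: in_keys_iff\<close>)

lemma boundary_zero [simp]: "boundary 0 = 0"
  by (simp add: boundary_def)

lemma boundary_add: "boundary (c + d) = boundary c + boundary d"
proof -
  let ?S = "Poly_Mapping.keys c \<union> Poly_Mapping.keys d"
  have "Poly_Mapping.keys (c + d) \<subseteq> ?S"
    by (rule Poly_Mapping.keys_add)
  then show ?thesis
    by (simp add: boundary_superset [of ?S] lookup_add distrib_left single_add sum.distrib)
qed

lemma boundary_uminus: "boundary (- c) = - boundary c"
  using boundary_add [of c "- c"] by (simp add: eq_neg_iff_add_eq_0 add.commute)

lemma boundary_sum: "boundary (sum f A) = (\<Sum>a\<in>A. boundary (f a))"
  by (induction A rule: infinite_finite_induct) (simp_all add: boundary_add)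

lemma boundary_single:
  "boundary (Poly_Mapping.single s a) =
     (\<Sum>x \<in> s. Poly_Mapping.single (s - {x}) ((- 1) ^ card {y \<in> s. y < x} * a))"
  by (subst boundary_superset [of "{s}"]) auto

lemma boundary_in_chain_space:
  assumes "c \<in> chain_space K P (k + 1)"
  shows "boundary c \<in> chain_space K P k"
proof -
  have face: "s - {x} \<in> simplices P k" if "s \<in> simplices P (k + 1)" "x \<in> s" for s x
  proof -
    have fin: "finite s" and "card s > 0"
      using that by (auto simp: simplices_def order_complex_def card_gt_0_iff)
    then have "int (card (s - {x})) = int (card s) - 1"
      using that by (simp add: card_Diff_singleton of_nat_diff)
    then show ?thesis
      using that fin by (auto simp: simplices_def order_complex_def Complete_Partial_Order.chain_def)
  qed
  show ?thesis
    using assms unfolding chain_space_def boundary_def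
    by (fastforce dest!: subsetD [OF keys_sum] split: if_splits intro: face)
qed

lemma boundary_boundary:
  assumes "c \<in> chain_space K P k"
  shows "boundary (boundary c) = 0"
proof -
  have "boundary (\<Sum>x\<in>s. Poly_Mapping.single (s - {x})
          ((- 1) ^ card {y \<in> s. y < x} * Poly_Mapping.lookup c s)) = 0" (is "?L = 0")
    if "s \<in> Poly_Mapping.keys c" for s
  proof -
    from that assms have fin: "finite s" and ch: "\<And>x y. x \<in> s \<Longrightarrow> y \<in> s \<Longrightarrow> x \<le> y \<or> y \<le> x"
      by (auto simp: chain_space_def simplices_def order_complex_def Complete_Partial_Order.chain_def)
    define a where "a = Poly_Mapping.lookup c s"
    define e where "e x t = (- 1 :: 'b) ^ card {y \<in> t. y < x}" for x and t :: "'a set"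
    define g where "g x z = Poly_Mapping.single (s - {x} - {z}) (e z (s - {x}) * (e x s * a))" for x z
    define S where "S = {(x, z). x \<in> s \<and> z \<in> s \<and> x \<noteq> z}"
    have sub: "S \<subseteq> s \<times> s" by (auto simp: S_def)
    then have finS: "finite S" using fin by (meson finite_SigmaI finite_subset)
    have "?L = (\<Sum>x\<in>s. \<Sum>z\<in>s - {x}. g x z)"
      by (simp add: boundary_sum boundary_single g_def e_def a_def)
    also have "\<dots> = (\<Sum>(x, z)\<in>S. g x z)"
      using fin by (subst sum.Sigma) (auto simp: S_def intro!: sum.cong)
    also have "\<dots> = (\<Sum>(x, z)\<in>{(x, z) \<in> S. x < z}. g x z) + (\<Sum>(x, z)\<in>{(x, z) \<in> S. z < x}. g x z)"
      using finS
      by (subst sum.union_disjoint [symmetric])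
        (auto simp: S_def intro!: sum.cong finite_subset [OF _ finS] dest: ch)
    also have "(\<Sum>(x, z)\<in>{(x, z) \<in> S. z < x}. g x z) = (\<Sum>(x, z)\<in>{(x, z) \<in> S. x < z}. g z x)"
      by (rule sum.reindex_bij_witness [of _ prod.swap prod.swap]) (auto simp: S_def)
    also have "(\<Sum>(x, z)\<in>{(x, z) \<in> S. x < z}. g z x) = (\<Sum>(x, z)\<in>{(x, z) \<in> S. x < z}. - g x z)"
    proof (intro sum.cong refl, clarify)
      fix x z assume "(x, z) \<in> S" and less: "x < z"
      then have xz: "x \<in> s" "z \<in> s" by (auto simp: S_def)
      have 1: "{y \<in> s - {z}. y < x} = {y \<in> s. y < x}" using less by auto
      have 2: "{y \<in> s. y < z} = insert x {y \<in> s - {x}. y < z}" using less xz by auto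
      have "e z s = - e z (s - {x})" using fin by (simp add: e_def 2)
      moreover have "e x (s - {z}) = e x s" unfolding e_def 1 ..
      moreover have "s - {x} - {z} = s - {z} - {x}" by auto
      ultimately show "g z x = - g x z"
        by (simp add: g_def single_uminus algebra_simps)
    qed
    finally show ?thesis by (simp add: sum_negf case_prod_unfold)
  qed
  then show ?thesis
    unfolding boundary_def [of c] boundary_sum [of _ "Poly_Mapping.keys c"] by simp
qed

lemma comm_group_cycle_group: "comm_group (cycle_group K P k)"
proof (rule comm_groupI)
  fix c assume "c \<in> carrier (cycle_group K P k)"
  then show "\<exists>d\<in>carrier (cycle_group K P k). d \<otimes>\<^bsub>cycle_group K P k\<^esub> c = \<one>\<^bsub>cycle_group K P k\<^esub>"
    by (intro bexI [of _ "- c"]) (auto simp: cycle_group_def cycles_def chain_space_def boundary_uminus)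
qed (auto simp: cycle_group_def cycles_def chain_space_def boundary_add algebra_simps
      dest!: subsetD [OF Poly_Mapping.keys_add])

lemma boundaries_subset_cycles: "boundaries K P k \<subseteq> cycles K P k"
  using boundary_in_chain_space boundary_boundary by (fastforce simp: boundaries_def cycles_def)

lemma subgroup_boundaries: "subgroup (boundaries K P k) (cycle_group K P k)"
proof -
  interpret comm_group "cycle_group K P k" by (rule comm_group_cycle_group)
  show ?thesis
  proof (rule subgroupI)
    show "boundaries K P k \<subseteq> carrier (cycle_group K P k)"
      using boundaries_subset_cycles by (auto simp: cycle_group_def)
    show "boundaries K P k \<noteq> {}"
      by (auto simp: boundaries_def chain_space_def intro: exI [of _ 0])
  next
    fix c assume c: "c \<in> boundaries K P k"
    then obtain d where "c = boundary d" "d \<in> chain_space K P (k + 1)"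
      by (auto simp: boundaries_def)
    then have "- c = boundary (- d)" "- d \<in> chain_space K P (k + 1)"
      by (auto simp: boundary_uminus chain_space_def)
    then have "- c \<in> boundaries K P k"
      by (auto simp: boundaries_def)
    moreover from this c have "inv\<^bsub>cycle_group K P k\<^esub> c = - c"
      using boundaries_subset_cycles by (intro inv_equality) (auto simp: cycle_group_def dest: subsetD)
    ultimately show "inv\<^bsub>cycle_group K P k\<^esub> c \<in> boundaries K P k" by simp
  next
    fix c d assume "c \<in> boundaries K P k" "d \<in> boundaries K P k"
    then obtain c' d' where "c = boundary c'" "d = boundary d'"
      "c' \<in> chain_space K P (k + 1)" "d' \<in> chain_space K P (k + 1)"
      by (auto simp: boundaries_def)
    then have "c + d = boundary (c' + d')" "c' + d' \<in> chain_space K P (k + 1)"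
      by (auto simp: boundary_add chain_space_def dest!: subsetD [OF Poly_Mapping.keys_add])
    then show "c \<otimes>\<^bsub>cycle_group K P k\<^esub> d \<in> boundaries K P k"
      by (auto simp: cycle_group_def boundaries_def)
  qed
qed

lemma comm_group_reduced_homology: "comm_group (reduced_homology K k P)"
  unfolding reduced_homology_def
  by (rule comm_group.abelian_FactGroup [OF comm_group_cycle_group subgroup_boundaries])

lemma trivial_reduced_homology_iff:
  "trivial_group (reduced_homology K k P) \<longleftrightarrow> cycles K P k \<subseteq> boundaries K P k"
proof -
  let ?C = "cycle_group K P k" and ?B = "boundaries K P k"
  interpret comm_group ?C by (rule comm_group_cycle_group)
  interpret Q: comm_group "?C Mod ?B"
    using comm_group_reduced_homology unfolding reduced_homology_def .
  have "trivial_group (?C Mod ?B) \<longleftrightarrow> (\<forall>c \<in> carrier ?C. ?B #>\<^bsub>?C\<^esub> c = ?B)"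
    unfolding Q.trivial_group_subset by (auto simp: FactGroup_def RCOSETS_def)
  also have "\<dots> \<longleftrightarrow> (\<forall>c \<in> carrier ?C. c \<in> ?B)"
    using subgroup_boundaries coset_join1 coset_join2 subgroup.subset by metis
  finally show ?thesis
    by (auto simp: reduced_homology_def cycle_group_def)
qed

lemma reduced_homology_empty: "\<not> trivial_group (reduced_homology K (- 1) {})"
proof -
  have "simplices {} 0 = ({} :: 'a set set)"
    by (auto simp: simplices_def order_complex_def)
  then have "boundaries K {} (- 1) = ({0} :: ('a set \<Rightarrow>\<^sub>0 'b) set)"
    by (auto simp: boundaries_def chain_space_def intro!: image_eqI [of _ _ 0])
  moreover have "Poly_Mapping.single {} 1 \<in> cycles K {} (- 1)"
    by (auto simp: cycles_def chain_space_def simplices_def order_complex_def boundary_single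
        Complete_Partial_Order.chain_def)
  ultimately show ?thesis
    by (metis trivial_reduced_homology_iff single_zero inj_single subsetD singletonD
        lookup_single_eq lookup_zero zero_neq_one)
qed

end

theory Submission
  imports Defs "HOL-Analysis.Cartesian_Space"
begin

text \<open>Write $\beta_i(x) = \dim \widetilde H_{i-2}((\hat 0,x))$. These are the multiplicities in a minimal
  projective resolution of the simple functor at $\hat 0$ on the lattice. Let $F$ be the bar resolution,
  whose generators in degree $p$ are the chains $\hat 0 < x_1 < \dots < x_p$, placed at $x_p$; the value
  $F(x)$ is spanned by the generators placed at or below $x$. Joins make $F \otimes F$, with generators
  placed at the join of two positions, a resolution of the same functor. Hence the maps
  $c \mapsto c \otimes 1$ and $c \mapsto 1 \otimes c$ are naturally homotopic, and there is a natural
  chain map $r : F \otimes F \to F$.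

  Let $c \in F_{a+b}(m)$ be a cycle modulo the part of $F$ strictly below $m$, and let $w$ be the value at
  $c$ of the homotopy. Cutting $w$ down to its components of bidegree $(p,q)$ with $p > a$ gives $u$ with
  $\partial u = c \otimes 1 + y$ modulo lower terms, where $y$ has bidegree $(a,b)$. If there are no $x, x'$
  with $x \vee x' = m$, $\beta_a(x) \neq 0$ and $\beta_b(x') \neq 0$, then suitable natural endomorphisms
  $e, e'$ of $F$ make $(e \otimes e')(y)$ lie strictly below $m$. Since $r \circ (e \otimes e')$ restricted
  to $F \otimes 1$ is homotopic to the identity, $c$ is a boundary modulo lower terms, so
  $\beta_{a+b}(m) = 0$.\<close>

section \<open>Vectors indexed by a finite type\<close>

abbreviation lin :: "('k::field ^ 'b \<Rightarrow> 'k ^ 'c) \<Rightarrow> bool" where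
  "lin \<equiv> Vector_Spaces.linear (*s) (*s)"

abbreviation unit_vec :: "'b::finite \<Rightarrow> 'k::field ^ 'b" (\<open>\<epsilon>\<close>) where
  "\<epsilon> b \<equiv> axis b 1"

text \<open>Coordinate subspaces carry all bookkeeping of degrees and positions: every graded or
  filtered piece below is \<open>supported X\<close> for some set \<open>X\<close> of
  generators.\<close>

definition supported :: "'b::finite set \<Rightarrow> ('k::field ^ 'b) set" where
  "supported X = {v. \<forall>b. v $ b \<noteq> 0 \<longrightarrow> b \<in> X}"

definition lin_ext :: "('b::finite \<Rightarrow> 'k::field ^ 'c) \<Rightarrow> 'k ^ 'b \<Rightarrow> 'k ^ 'c" where
  "lin_ext g v = (\<Sum>b\<in>UNIV. v $ b *s g b)"

definition proj :: "'b::finite set \<Rightarrow> 'k::field ^ 'b \<Rightarrow> 'k ^ 'b" where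
  "proj X v = (\<chi> b. if b \<in> X then v $ b else 0)"

lemma lin_iff:
  "lin f \<longleftrightarrow> (\<forall>u v. f (u + v) = f u + f v) \<and> (\<forall>c v. f (c *s v) = c *s f v)"
  by (simp add: Vector_Spaces.linear_iff vec.vector_space_axioms)

lemma lin_add: "lin f \<Longrightarrow> f (u + v) = f u + f v"
  and lin_scale: "lin f \<Longrightarrow> f (c *s v) = c *s f v"
  by (simp_all add: lin_iff)

lemma lin_zero: "lin f \<Longrightarrow> f 0 = 0"
  using lin_scale [of f 0 0] by simp

lemma lin_uminus: "lin f \<Longrightarrow> f (- v) = - f v"
  using lin_scale [of f "- 1" v] by simp

lemma lin_diff: "lin f \<Longrightarrow> f (u - v) = f u - f v"
  using lin_add [of f u "- v"] by (simp add: lin_uminus)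

lemma lin_sum: "lin f \<Longrightarrow> f (sum g A) = (\<Sum>a\<in>A. f (g a))"
  by (induction A rule: infinite_finite_induct) (simp_all add: lin_add lin_zero)

lemma lin_ident: "lin (\<lambda>v. v)"
  by (simp add: lin_iff)

lemma lin_null: "lin (\<lambda>_. 0)"
  by (simp add: lin_iff)

lemma lin_comp: "lin f \<Longrightarrow> lin g \<Longrightarrow> lin (\<lambda>v. f (g v))"
  by (simp add: lin_iff)

lemma lin_plus: "lin f \<Longrightarrow> lin g \<Longrightarrow> lin (\<lambda>v. f v + g v)"
  by (simp add: lin_iff vec.scale_right_distrib algebra_simps)

lemma lin_minus: "lin f \<Longrightarrow> lin g \<Longrightarrow> lin (\<lambda>v. f v - g v)"
  by (simp add: lin_iff vec.scale_right_diff_distrib algebra_simps)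

lemma lin_funpow: "lin (f :: 'k::field ^ 'b \<Rightarrow> 'k ^ 'b) \<Longrightarrow> lin (f ^^ n)"
  by (induction n) (simp_all add: lin_iff)

lemma lin_lin_ext: "lin (lin_ext g)"
  by (simp add: lin_iff lin_ext_def vec.scale_left_distrib sum.distrib vec.scale_sum_right)

lemma lin_proj: "lin (proj X)"
  by (simp add: lin_iff proj_def vec_eq_iff)

lemma expand_unit_vec: "v = (\<Sum>b\<in>UNIV. v $ b *s \<epsilon> b)"
  by (simp add: basis_expansion)

lemma lin_ext_unit_vec [simp]: "lin_ext g (\<epsilon> b) = g b"
proof -
  have "lin_ext g (\<epsilon> b) = (\<Sum>c\<in>UNIV. if c = b then g b else 0)"
    unfolding lin_ext_def by (intro sum.cong) (auto simp: axis_def)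
  then show ?thesis by simp
qed

lemma supportedI: "(\<And>b. b \<notin> X \<Longrightarrow> v $ b = 0) \<Longrightarrow> v \<in> supported X"
  and supportedD: "v \<in> supported X \<Longrightarrow> b \<notin> X \<Longrightarrow> v $ b = 0"
  by (auto simp: supported_def)

lemma zero_in_supported [simp]: "0 \<in> supported X"
  and supported_add: "u \<in> supported X \<Longrightarrow> v \<in> supported X \<Longrightarrow> u + v \<in> supported X"
  and supported_diff: "u \<in> supported X \<Longrightarrow> v \<in> supported X \<Longrightarrow> u - v \<in> supported X"
  and supported_scale: "u \<in> supported X \<Longrightarrow> c *s u \<in> supported X"
  by (rule supportedI; simp add: supportedD)+

lemma supported_empty: "supported {} = {0}"
  by (auto simp: supported_def vec_eq_iff)

lemma supported_mono: "X \<subseteq> Y \<Longrightarrow> supported X \<subseteq> supported Y"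
  by (auto simp: supported_def)

lemma unit_vec_in_supported [simp]: "\<epsilon> b \<in> supported X \<longleftrightarrow> b \<in> X"
  by (auto simp: supported_def axis_def)

lemma supported_sum: "(\<And>a. a \<in> A \<Longrightarrow> f a \<in> supported X) \<Longrightarrow> sum f A \<in> supported X"
  by (induction A rule: infinite_finite_induct) (simp_all add: supported_add)

lemma subspace_supported: "vec.subspace (supported X)"
  by (simp add: vec.subspace_def supported_add supported_scale)

lemma expand_supported: "v \<in> supported X \<Longrightarrow> v = (\<Sum>b\<in>X. v $ b *s \<epsilon> b)"
  by (subst (1) expand_unit_vec) (auto simp: supported_def intro!: sum.mono_neutral_right)

lemma proj_supported: "v \<in> supported Y \<Longrightarrow> proj X v \<in> supported (X \<inter> Y)"
  by (auto simp: proj_def supported_def)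

lemma proj_ident: "v \<in> supported X \<Longrightarrow> proj X v = v"
  and proj_eq_0: "v \<in> supported (- X) \<Longrightarrow> proj X v = 0"
  by (auto simp: proj_def supported_def vec_eq_iff)

lemma proj_unit_vec: "proj X (\<epsilon> b) = (if b \<in> X then \<epsilon> b else 0)"
  by (auto simp: proj_def vec_eq_iff axis_def)

lemma supported_image:
  assumes "lin f" "v \<in> supported X" "\<And>b. b \<in> X \<Longrightarrow> f (\<epsilon> b) \<in> supported Y"
  shows "f v \<in> supported Y"
  by (subst expand_supported [OF assms(2)])
    (auto simp: lin_sum [OF assms(1)] lin_scale [OF assms(1)] assms(3) intro!: supported_sum supported_scale)

lemma lin_eq_on_supported:
  assumes "lin f" "lin g" "v \<in> supported X" "\<And>b. b \<in> X \<Longrightarrow> f (\<epsilon> b) = g (\<epsilon> b)"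
  shows "f v = g v"
  by (subst (1 2) expand_supported [OF assms(3)])
    (simp add: lin_sum [OF assms(1)] lin_sum [OF assms(2)] lin_scale [OF assms(1)]
      lin_scale [OF assms(2)] assms(4))

lemma lin_eqI:
  assumes "lin f" "lin g" "\<And>b. f (\<epsilon> b) = g (\<epsilon> b)"
  shows "f v = g v"
  by (rule lin_eq_on_supported [of f g v UNIV]) (use assms in \<open>auto simp: supported_def\<close>)

section \<open>Filtered complexes and acyclic models\<close>

text \<open>A complex of free functors on the poset: the generator \<open>b\<close> sits at
  \<open>pos b\<close>, and the value at x is \<open>below x\<close>. The set \<open>B\<close>
  singles out the generators, since the index types used later also contain sets that are not
  chains. At \<open>bot\<close> only \<open>base\<close> survives, so the value there is one copy of
  the field in degree 0.\<close>

locale filtered_complex =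
  fixes B :: "'b::finite set" and deg :: "'b \<Rightarrow> nat" and pos :: "'b \<Rightarrow> 'a::order_bot"
    and d :: "'k::field ^ 'b \<Rightarrow> 'k ^ 'b" and base :: 'b
  assumes lin_d: "lin d"
    and d_unit_vec: "b \<in> B \<Longrightarrow> d (\<epsilon> b) \<in> supported {c \<in> B. Suc (deg c) = deg b \<and> pos c \<le> pos b}"
    and d_d: "d (d v) = 0"
    and base_in_B: "base \<in> B"
    and deg_0_iff: "b \<in> B \<Longrightarrow> deg b = 0 \<longleftrightarrow> b = base"
    and pos_bot_iff: "b \<in> B \<Longrightarrow> pos b = bot \<longleftrightarrow> b = base"
begin

abbreviation below :: "'a \<Rightarrow> ('k ^ 'b) set" where
  "below x \<equiv> supported {b \<in> B. pos b \<le> x}"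

lemma d_base: "d (\<epsilon> base) = 0"
  using d_unit_vec [OF base_in_B] deg_0_iff [OF base_in_B] by (simp add: supported_def vec_eq_iff)

lemma d_below: "v \<in> below x \<Longrightarrow> d v \<in> below x"
proof (rule supported_image [OF lin_d], assumption)
  fix b assume "b \<in> {b \<in> B. pos b \<le> x}"
  then show "d (\<epsilon> b) \<in> below x"
    by (intro subsetD [OF supported_mono d_unit_vec]) auto
qed

lemma d_unit_vec_below: "b \<in> B \<Longrightarrow> d (\<epsilon> b) \<in> below (pos b)"
  by (rule d_below) simp

lemma agree_on_d:
  assumes "lin f" "lin g" "b \<in> B" "deg b = Suc n"
    and "\<And>c. c \<in> B \<Longrightarrow> deg c \<le> n \<Longrightarrow> f (\<epsilon> c) = g (\<epsilon> c)"
  shows "f (d (\<epsilon> b)) = g (d (\<epsilon> b))"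
  by (rule lin_eq_on_supported [OF assms(1,2) d_unit_vec [OF assms(3)]]) (simp add: assms(4,5))

end

text \<open>Exactness at every position other than \<open>bot\<close>, given by a contraction that
  may depend on x in any way. Such a complex resolves the simple functor at
  \<open>bot\<close>.\<close>

locale contractible_complex = filtered_complex B deg pos d base
  for B :: "'b::finite set" and deg :: "'b \<Rightarrow> nat" and pos :: "'b \<Rightarrow> 'a::order_bot"
    and d :: "'k::field ^ 'b \<Rightarrow> 'k ^ 'b" and base :: 'b +
  fixes S :: "'a \<Rightarrow> 'k ^ 'b \<Rightarrow> 'k ^ 'b"
  assumes lin_S: "lin (S x)"
    and S_below: "x \<noteq> bot \<Longrightarrow> v \<in> below x \<Longrightarrow> S x v \<in> below x"
    and d_S: "x \<noteq> bot \<Longrightarrow> v \<in> below x \<Longrightarrow> d (S x v) + S x (d v) = v"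


lemma natural_below:
  fixes Y :: "'a::order \<Rightarrow> ('k::field ^ 'c) set"
  assumes "lin f" "\<And>b. b \<in> X \<Longrightarrow> f (\<epsilon> b) \<in> supported {c \<in> C. q c \<le> p b}"
    and "v \<in> supported {b \<in> X. p b \<le> x}"
  shows "f v \<in> supported {c \<in> C. q c \<le> (x :: 'a::order)}"
proof (rule supported_image [OF assms(1,3)])
  fix b assume "b \<in> {b \<in> X. p b \<le> x}"
  then show "f (\<epsilon> b) \<in> supported {c \<in> C. q c \<le> x}"
    by (intro subsetD [OF supported_mono assms(2)]) auto
qed

lemma natural_strictly_below:
  assumes "lin f" "\<And>b. b \<in> X \<Longrightarrow> f (\<epsilon> b) \<in> supported {c \<in> C. q c \<le> p b}"
    and "v \<in> supported {b \<in> X. p b < x}"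
  shows "f v \<in> supported {c \<in> C. q c < (x :: 'a::order)}"
proof (rule supported_image [OF assms(1,3)])
  fix b assume "b \<in> {b \<in> X. p b < x}"
  then show "f (\<epsilon> b) \<in> supported {c \<in> C. q c < x}"
    by (intro subsetD [OF supported_mono assms(2)]) auto
qed

section \<open>Comparison theorem for natural chain maps and homotopies\<close>

locale complex_pair =
  X: filtered_complex X degX posX dX baseX + Y: contractible_complex Y degY posY dY baseY S
  for X :: "'b::finite set" and degX and posX :: "'b \<Rightarrow> 'a::order_bot"
    and dX :: "'k::field ^ 'b \<Rightarrow> 'k ^ 'b" and baseX
    and Y :: "'c::finite set" and degY and posY :: "'c \<Rightarrow> 'a"
    and dY :: "'k ^ 'c \<Rightarrow> 'k ^ 'c" and baseY and S
begin

text \<open>By the Yoneda lemma, a natural transformation out of a free functor amounts to choosing,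
  for each generator, an element of the target's value at its position.\<close>

definition natural :: "('k ^ 'b \<Rightarrow> 'k ^ 'c) \<Rightarrow> bool" where
  "natural f \<longleftrightarrow> lin f \<and> (\<forall>b\<in>X. f (\<epsilon> b) \<in> Y.below (posX b))"

definition chain_map :: "('k ^ 'b \<Rightarrow> 'k ^ 'c) \<Rightarrow> bool" where
  "chain_map f \<longleftrightarrow> natural f \<and> f (\<epsilon> baseX) = \<epsilon> baseY \<and> (\<forall>v\<in>supported X. dY (f v) = f (dX v))"

lemma naturalD:
  assumes "natural f"
  shows "lin f" "v \<in> X.below x \<Longrightarrow> f v \<in> Y.below x"
    "v \<in> supported {b \<in> X. posX b < x} \<Longrightarrow> f v \<in> supported {c \<in> Y. posY c < x}"
  using assms natural_below [of f X Y posY posX] natural_strictly_below [of f X Y posY posX]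
  by (auto simp: natural_def)

lemma chain_mapI:
  assumes "natural f" "f (\<epsilon> baseX) = \<epsilon> baseY" "\<And>b. b \<in> X \<Longrightarrow> dY (f (\<epsilon> b)) = f (dX (\<epsilon> b))"
  shows "chain_map f"
  unfolding chain_map_def
proof (intro conjI ballI assms)
  have lin_f: "lin f" using assms(1) by (simp add: natural_def)
  show "dY (f v) = f (dX v)" if "v \<in> supported X" for v
    by (rule lin_eq_on_supported [OF lin_comp [OF Y.lin_d lin_f] lin_comp [OF lin_f X.lin_d] that])
      (simp_all add: assms(3))
qed

text \<open>Induction on the degree: for \<open>b\<close> in degree n + 1 the element
  \<open>f (dX (\<epsilon> b))\<close> is a cycle in the value at \<open>posX b\<close>, and the
  contraction there gives a preimage under \<open>dY\<close>. Positive degree forces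
  \<open>posX b\<close> to differ from \<open>bot\<close>, so the contraction is available.\<close>

lemma partial_chain_map_exists:
  "\<exists>f. natural f \<and> f (\<epsilon> baseX) = \<epsilon> baseY \<and> (\<forall>b\<in>X. degX b \<le> n \<longrightarrow> dY (f (\<epsilon> b)) = f (dX (\<epsilon> b)))"
proof (induction n)
  case 0
  \<comment> \<open>Only the value on \<open>baseX\<close> matters at this stage;
    \<open>baseY\<close> sits at \<open>bot\<close> and so is an admissible value for every
    generator.\<close>
  have "natural (lin_ext (\<lambda>b. \<epsilon> baseY))"
    using Y.base_in_B Y.pos_bot_iff [of baseY] by (auto simp: natural_def lin_lin_ext)
  moreover have "dY (lin_ext (\<lambda>b. \<epsilon> baseY) (\<epsilon> b)) = lin_ext (\<lambda>b. \<epsilon> baseY) (dX (\<epsilon> b))"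
    if "b \<in> X" "degX b \<le> 0" for b
  proof -
    have "b = baseX" using X.deg_0_iff that by auto
    then show ?thesis by (simp add: X.d_base Y.d_base lin_zero [OF lin_lin_ext])
  qed
  ultimately show ?case by (intro exI [of _ "lin_ext (\<lambda>b. \<epsilon> baseY)"]) simp
next
  case (Suc n)
  then obtain f where nat: "natural f" and base: "f (\<epsilon> baseX) = \<epsilon> baseY"
    and comm: "\<And>b. b \<in> X \<Longrightarrow> degX b \<le> n \<Longrightarrow> dY (f (\<epsilon> b)) = f (dX (\<epsilon> b))"
    by blast
  have lin_f: "lin f" using nat by (simp add: natural_def)
  \<comment> \<open>Above degree n + 1 these values are placeholders, which only have to respect
    positions; later stages replace them.\<close>
  define g where "g = lin_ext (\<lambda>b. if degX b \<le> n then f (\<epsilon> b) else S (posX b) (f (dX (\<epsilon> b))))"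
  have g: "g (\<epsilon> b) = (if degX b \<le> n then f (\<epsilon> b) else S (posX b) (f (dX (\<epsilon> b))))" for b
    by (simp add: g_def)
  have lin_g: "lin g" by (simp add: g_def lin_lin_ext)
  have gd: "g (dX (\<epsilon> b)) = f (dX (\<epsilon> b))" if "b \<in> X" "degX b \<le> Suc n" for b
  proof (cases "degX b")
    case 0
    then have "b = baseX" using X.deg_0_iff that by auto
    then show ?thesis by (simp add: X.d_base lin_zero [OF lin_f] lin_zero [OF lin_g])
  next
    case (Suc k)
    then show ?thesis using that by (intro X.agree_on_d [OF lin_g lin_f _ Suc]) (auto simp: g)
  qed
  have fd: "f (dX (\<epsilon> b)) \<in> Y.below (posX b)" if "b \<in> X" for b
    by (rule naturalD [OF nat] X.d_unit_vec_below that)+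
  have not_bot: "posX b \<noteq> bot" if "b \<in> X" "\<not> degX b \<le> n" for b
    using X.pos_bot_iff [OF that(1)] X.deg_0_iff [OF that(1)] that(2) by auto
  have "natural g"
    unfolding natural_def
  proof (intro conjI ballI lin_g)
    fix b assume "b \<in> X"
    then show "g (\<epsilon> b) \<in> Y.below (posX b)"
      using nat fd not_bot Y.S_below by (auto simp: g natural_def)
  qed
  moreover have "g (\<epsilon> baseX) = \<epsilon> baseY"
    using X.deg_0_iff [OF X.base_in_B] by (simp add: g base)
  moreover have "dY (g (\<epsilon> b)) = g (dX (\<epsilon> b))" if b: "b \<in> X" "degX b \<le> Suc n" for b
  proof (cases "degX b \<le> n")
    case True
    then show ?thesis using b comm gd by (simp add: g)
  next
    case False
    \<comment> \<open>The differential of \<open>b\<close> has degree n, where \<open>f\<close>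
      already commutes with the differentials.\<close>
    have "dY (f (dX (\<epsilon> b))) = f (dX (dX (\<epsilon> b)))"
      by (rule X.agree_on_d [OF lin_comp [OF Y.lin_d lin_f] lin_comp [OF lin_f X.lin_d], of b n])
        (use b False comm in auto)
    then have "dY (f (dX (\<epsilon> b))) = 0"
      by (simp add: X.d_d lin_zero [OF lin_f])
    then show ?thesis
      using Y.d_S [OF not_bot [OF b(1) False] fd [OF b(1)]] gd [OF b] False
      by (simp add: g lin_zero [OF Y.lin_S])
  qed
  ultimately show ?case by blast
qed

lemma chain_map_exists: "\<exists>f. chain_map f"
proof -
  \<comment> \<open>The index type is finite, so one bound on the degree covers all
    generators.\<close>
  obtain f where "natural f" "f (\<epsilon> baseX) = \<epsilon> baseY"
      "\<And>b. b \<in> X \<Longrightarrow> degX b \<le> Max (range degX) \<Longrightarrow> dY (f (\<epsilon> b)) = f (dX (\<epsilon> b))"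
    using partial_chain_map_exists by blast
  then have "chain_map f" by (intro chain_mapI) auto
  then show ?thesis by blast
qed

text \<open>The same induction: the defect of a homotopy built up to degree n is a cycle on
  generators of degree n + 1, and the contraction fills it. In degree 0 both maps agree on
  \<open>baseX\<close>, so the zero homotopy will do.\<close>

lemma partial_homotopy_exists:
  assumes f: "chain_map f" and g: "chain_map g"
  shows "\<exists>h. natural h \<and>
    (\<forall>b\<in>X. degX b \<le> n \<longrightarrow> f (\<epsilon> b) - g (\<epsilon> b) = dY (h (\<epsilon> b)) + h (dX (\<epsilon> b)))"
proof (induction n)
  case 0
  have "f (\<epsilon> b) - g (\<epsilon> b) = dY (lin_ext (\<lambda>b. 0) (\<epsilon> b)) + lin_ext (\<lambda>b. 0) (dX (\<epsilon> b))"
    if "b \<in> X" "degX b \<le> 0" for b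
  proof -
    have "b = baseX" using X.deg_0_iff that by auto
    then show ?thesis
      using f g by (simp add: X.d_base chain_map_def lin_zero [OF lin_lin_ext] lin_zero [OF Y.lin_d])
  qed
  then show ?case by (intro exI [of _ "lin_ext (\<lambda>b. 0)"]) (auto simp: natural_def lin_lin_ext)
next
  case (Suc n)
  then obtain h where nat: "natural h"
    and htpy: "\<And>b. b \<in> X \<Longrightarrow> degX b \<le> n \<Longrightarrow>
      f (\<epsilon> b) - g (\<epsilon> b) = dY (h (\<epsilon> b)) + h (dX (\<epsilon> b))"
    by blast
  have nat_f: "natural f" and nat_g: "natural g"
    using f g by (auto simp: chain_map_def)
  have lin_f: "lin f" and lin_g: "lin g" and lin_h: "lin h"
    using nat nat_f nat_g by (auto simp: natural_def)
  \<comment> \<open>The value \<open>e (\<epsilon> b)\<close> is what \<open>dY\<close> of the new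
    homotopy has to hit.\<close>
  define e where "e v = f v - g v - h (dX v)" for v
  have lin_e: "lin e"
    unfolding e_def by (intro lin_minus lin_comp [OF lin_h X.lin_d] lin_f lin_g)
  define k where "k = lin_ext (\<lambda>b. if degX b \<le> n then h (\<epsilon> b) else S (posX b) (e (\<epsilon> b)))"
  have k: "k (\<epsilon> b) = (if degX b \<le> n then h (\<epsilon> b) else S (posX b) (e (\<epsilon> b)))" for b
    by (simp add: k_def)
  have lin_k: "lin k" by (simp add: k_def lin_lin_ext)
  have kd: "k (dX (\<epsilon> b)) = h (dX (\<epsilon> b))" if "b \<in> X" "degX b \<le> Suc n" for b
  proof (cases "degX b")
    case 0
    then have "b = baseX" using X.deg_0_iff that by auto
    then show ?thesis by (simp add: X.d_base lin_zero [OF lin_h] lin_zero [OF lin_k])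
  next
    case (Suc i)
    then show ?thesis using that by (intro X.agree_on_d [OF lin_k lin_h _ Suc]) (auto simp: k)
  qed
  have e_below: "e (\<epsilon> b) \<in> Y.below (posX b)" if "b \<in> X" for b
    unfolding e_def
    by (intro supported_diff naturalD(2) [OF nat] X.d_unit_vec_below that)
      (use nat_f nat_g that in \<open>auto simp: natural_def\<close>)
  have not_bot: "posX b \<noteq> bot" if "b \<in> X" "\<not> degX b \<le> n" for b
    using X.pos_bot_iff [OF that(1)] X.deg_0_iff [OF that(1)] that(2) by auto
  have "natural k"
    unfolding natural_def
  proof (intro conjI ballI lin_k)
    fix b assume "b \<in> X"
    then show "k (\<epsilon> b) \<in> Y.below (posX b)"
      using nat e_below not_bot Y.S_below by (auto simp: k natural_def)
  qed
  moreover have "f (\<epsilon> b) - g (\<epsilon> b) = dY (k (\<epsilon> b)) + k (dX (\<epsilon> b))"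
    if b: "b \<in> X" "degX b \<le> Suc n" for b
  proof (cases "degX b \<le> n")
    case True
    then show ?thesis using b htpy kd by (simp add: k)
  next
    case False
    \<comment> \<open>In degrees up to n the induction hypothesis reads
      \<open>e = dY \<circ> h\<close>. As \<open>e (dX (\<epsilon> b))\<close> is also
      \<open>f (dX (\<epsilon> b)) - g (dX (\<epsilon> b))\<close>, the differential of
      \<open>e (\<epsilon> b)\<close> vanishes.\<close>
    have "e (dX (\<epsilon> b)) = dY (h (dX (\<epsilon> b)))"
    proof (rule X.agree_on_d [OF lin_e lin_comp [OF Y.lin_d lin_h], of b n])
      fix c assume "c \<in> X" "degX c \<le> n"
      then show "e (\<epsilon> c) = dY (h (\<epsilon> c))"
        using htpy [of c] by (simp add: e_def)
    qed (use b False in auto)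
    moreover have "dY (f (\<epsilon> b)) = f (dX (\<epsilon> b))" "dY (g (\<epsilon> b)) = g (dX (\<epsilon> b))"
      using f g b by (auto simp: chain_map_def)
    ultimately have "dY (e (\<epsilon> b)) = 0"
      by (simp add: e_def lin_diff [OF Y.lin_d] X.d_d lin_zero [OF lin_h])
    then have "dY (k (\<epsilon> b)) = e (\<epsilon> b)"
      using Y.d_S [OF not_bot [OF b(1) False] e_below [OF b(1)]] False
      by (simp add: k lin_zero [OF Y.lin_S])
    then show ?thesis
      by (simp add: kd b e_def)
  qed
  ultimately show ?case by blast
qed

lemma homotopy_exists:
  assumes f: "chain_map f" and g: "chain_map g"
  shows "\<exists>h. natural h \<and> (\<forall>v\<in>supported X. f v - g v = dY (h v) + h (dX v))"
proof -
  obtain h where h: "natural h"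
    "\<And>b. b \<in> X \<Longrightarrow> degX b \<le> Max (range degX) \<Longrightarrow>
      f (\<epsilon> b) - g (\<epsilon> b) = dY (h (\<epsilon> b)) + h (dX (\<epsilon> b))"
    using partial_homotopy_exists [OF assms] by blast
  have lin: "lin f" "lin g" "lin h"
    using h(1) assms by (auto simp: natural_def chain_map_def)
  have "f v - g v = dY (h v) + h (dX v)" if "v \<in> supported X" for v
    by (rule lin_eq_on_supported [OF lin_minus [OF lin(1,2)]
          lin_plus [OF lin_comp [OF Y.lin_d lin(3)] lin_comp [OF lin(3) X.lin_d]] that])
      (simp add: h(2))
  with h(1) show ?thesis by blast
qed

end

section \<open>The bar resolution and its tensor square\<close>

text \<open>The least element shared by all chains of the resolution is left implicit, so
  \<open>card s\<close> is the degree and the empty set is the generator of degree 0.\<close>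

definition bar :: "'a::{finite, bounded_lattice_bot} set set" where
  "bar = order_complex {bot<..}"

text \<open>Inserting \<open>bot\<close> does not change a supremum and places the empty chain at
  \<open>bot\<close>.\<close>

definition height :: "'a::{finite, bounded_lattice_bot} set \<Rightarrow> 'a" where
  "height s = Sup_fin (insert bot s)"

lemma bar_iff: "s \<in> bar \<longleftrightarrow> bot \<notin> s \<and> (\<forall>x\<in>s. \<forall>y\<in>s. x \<le> y \<or> y \<le> x)"
  by (auto simp: bar_def order_complex_def Complete_Partial_Order.chain_def subset_iff simp flip: bot.not_eq_extremum)

lemma bar_mono: "s \<in> bar \<Longrightarrow> t \<subseteq> s \<Longrightarrow> t \<in> bar"
  by (auto simp: bar_iff)

lemma empty_in_bar [simp]: "{} \<in> bar"
  by (simp add: bar_iff)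

lemma height_le_iff: "height s \<le> x \<longleftrightarrow> (\<forall>y\<in>s. y \<le> x)"
  by (simp add: height_def Sup_fin.bounded_iff)

lemma height_upper: "y \<in> s \<Longrightarrow> y \<le> height s"
  using height_le_iff [of s "height s"] by simp

lemma height_mono: "t \<subseteq> s \<Longrightarrow> height t \<le> height s"
  by (auto simp: height_le_iff height_upper)

lemma height_empty [simp]: "height {} = bot"
  by (simp add: height_def)

lemma height_eq_bot_iff: "s \<in> bar \<Longrightarrow> height s = bot \<longleftrightarrow> s = {}"
  using height_upper [of _ s] by (fastforce simp: bar_iff bot_unique)

lemma height_in:
  assumes "s \<in> bar" "s \<noteq> {}"
  shows "height s \<in> s"
proof -
  have "finite s" by simp
  obtain x where x: "x \<in> s" "\<forall>y\<in>s. x \<le> y \<longrightarrow> x = y"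
    using finite_has_maximal [OF \<open>finite s\<close> assms(2)] by blast
  then have "height s \<le> x"
    using assms(1) by (auto simp: height_le_iff bar_iff)
  with x height_upper show ?thesis by (metis order.antisym)
qed

definition sgn_pos :: "'a::order set \<Rightarrow> 'a \<Rightarrow> 'k::field" where
  "sgn_pos s z = (- 1) ^ card {y \<in> s. y < z}"

text \<open>Declaring the boundary to vanish on sets that are not chains makes it square to zero on the whole
  vector space.\<close>

definition bd :: "'k::field ^ ('a::{finite, bounded_lattice_bot} set) \<Rightarrow> 'k ^ ('a set)" where
  "bd = lin_ext (\<lambda>s. if s \<in> bar then \<Sum>z\<in>s. sgn_pos s z *s \<epsilon> (s - {z}) else 0)"

text \<open>The sign is that of the face omitting \<open>x\<close> when \<open>x\<close> lies above
  \<open>s\<close>, so this face of the cone is \<open>s\<close> with coefficient 1.\<close>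

definition cone :: "'a::{finite, bounded_lattice_bot} \<Rightarrow> 'k::field ^ ('a set) \<Rightarrow> 'k ^ ('a set)" where
  "cone x = lin_ext (\<lambda>s. if x \<in> s then 0 else (- 1) ^ card s *s \<epsilon> (insert x s))"

lemma lin_bd: "lin bd" and lin_cone: "lin (cone x)"
  by (simp_all add: bd_def cone_def lin_lin_ext)

lemma bd_unit_vec: "s \<in> bar \<Longrightarrow> bd (\<epsilon> s) = (\<Sum>z\<in>s. sgn_pos s z *s \<epsilon> (s - {z}))"
  and bd_unit_vec_outside: "s \<notin> bar \<Longrightarrow> bd (\<epsilon> s) = 0"
  by (simp_all add: bd_def)

lemma bd_unit_vec_supported:
  "s \<in> bar \<Longrightarrow> bd (\<epsilon> s) \<in> supported {t \<in> bar. Suc (card t) = card s \<and> height t \<le> height s}"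
  using card_Suc_Diff1 [of s] bar_mono [of s] height_mono [of _ s]
  by (auto simp: bd_unit_vec simp del: card_Diff_insert intro!: supported_sum supported_scale)

section \<open>Passage from finitely supported functions to vectors\<close>

definition to_vec :: "('b::finite \<Rightarrow>\<^sub>0 'k::field) \<Rightarrow> 'k ^ 'b" where
  "to_vec c = (\<chi> s. Poly_Mapping.lookup c s)"

lemma to_vec_zero [simp]: "to_vec 0 = 0"
  and to_vec_add: "to_vec (c + e) = to_vec c + to_vec e"
  by (simp_all add: to_vec_def vec_eq_iff lookup_add)

lemma to_vec_single: "to_vec (Poly_Mapping.single s a) = a *s \<epsilon> s"
  by (simp add: to_vec_def vec_eq_iff lookup_single axis_def when_def)

lemma to_vec_sum: "to_vec (sum f A) = (\<Sum>x\<in>A. to_vec (f x))"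
  by (induction A rule: infinite_finite_induct) (simp_all add: to_vec_add)

lemma bd_to_vec:
  assumes "Poly_Mapping.keys c \<subseteq> bar"
  shows "bd (to_vec c) = to_vec (boundary c)"
proof -
  have "to_vec c \<in> supported (Poly_Mapping.keys c)"
    by (auto simp: supported_def to_vec_def in_keys_iff)
  then have "to_vec c = (\<Sum>s\<in>Poly_Mapping.keys c. Poly_Mapping.lookup c s *s \<epsilon> s)"
    by (subst expand_supported) (auto simp: to_vec_def)
  then have "bd (to_vec c) = (\<Sum>s\<in>Poly_Mapping.keys c. Poly_Mapping.lookup c s *s bd (\<epsilon> s))"
    by (simp add: lin_sum [OF lin_bd] lin_scale [OF lin_bd])
  also have "\<dots> = to_vec (boundary c)"
    using assms unfolding boundary_def
    by (auto simp: to_vec_sum to_vec_single bd_unit_vec sgn_pos_def vec.scale_sum_right mult.commute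
        intro!: sum.cong)
  finally show ?thesis .
qed

text \<open>Transported from \<open>boundary_boundary\<close> on chains; on all other sets
  \<open>bd\<close> is zero already.\<close>

lemma bd_bd:
  fixes v :: "'k::field ^ ('a::{finite, bounded_lattice_bot} set)"
  shows "bd (bd v) = 0"
proof (rule lin_eqI [of "\<lambda>v. bd (bd v)" "\<lambda>v. 0"])
  fix s :: "'a set"
  show "bd (bd (\<epsilon> s)) = (0 :: 'k ^ ('a set))"
  proof (cases "s \<in> bar")
    case True
    define c where "c = Poly_Mapping.single s (1 :: 'k)"
    have keys: "Poly_Mapping.keys c \<subseteq> bar"
      using True by (simp add: c_def)
    have "c \<in> chain_space TYPE('k) {bot<..} (int (card s) - 1)"
      using True by (simp add: c_def chain_space_def simplices_def bar_def)
    then have bb: "boundary (boundary c) = 0" "boundary c \<in> chain_space TYPE('k) {bot<..} (int (card s) - 1 - 1)"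
      using boundary_boundary boundary_in_chain_space [of c "TYPE('k)" _ "int (card s) - 1 - 1"] by auto
    then have "Poly_Mapping.keys (boundary c) \<subseteq> bar"
      by (auto simp: chain_space_def simplices_def bar_def)
    then have "bd (bd (to_vec c)) = 0"
      by (simp add: bd_to_vec keys bb)
    then show ?thesis by (simp add: c_def to_vec_single)
  qed (simp add: bd_unit_vec_outside lin_zero [OF lin_bd])
qed (simp_all add: lin_comp [OF lin_bd lin_bd] lin_iff)

text \<open>If \<open>x\<close> belongs to \<open>s\<close>, it is the top: the cone kills
  \<open>s\<close> and every face still containing \<open>x\<close>, and the cone over the remaining
  face is \<open>s\<close>, its sign occurring twice. Otherwise the faces of the cone are
  \<open>s\<close> itself and the cones over the faces of \<open>s\<close>, which enter the second
  summand with the opposite sign.\<close>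

lemma bd_cone_unit_vec:
  assumes "x \<noteq> bot" "s \<in> bar" "height s \<le> x"
  shows "bd (cone x (\<epsilon> s)) + cone x (bd (\<epsilon> s)) = (\<epsilon> s :: 'k::field ^ _)"
proof (cases "x \<in> s")
  case True
  have le: "y \<le> x" if "y \<in> s" for y
    using assms(3) that by (simp add: height_le_iff)
  have "cone x (bd (\<epsilon> s)) = (\<Sum>z\<in>s. (sgn_pos s z :: 'k) *s cone x (\<epsilon> (s - {z})))"
    by (simp add: bd_unit_vec assms(2) lin_sum [OF lin_cone] lin_scale [OF lin_cone])
  also have "\<dots> = (\<Sum>z\<in>{x}. (sgn_pos s z :: 'k) *s cone x (\<epsilon> (s - {z})))"
    using True by (intro sum.mono_neutral_right) (auto simp: cone_def)
  also have "\<dots> = \<epsilon> s"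
  proof -
    have "{y \<in> s. y < x} = s - {x}"
      using le by (auto simp: less_le)
    then show ?thesis
      using True by (simp add: cone_def sgn_pos_def insert_absorb vec.scale_scale flip: power_add mult_2)
  qed
  finally show ?thesis
    using True by (simp add: cone_def lin_zero [OF lin_bd])
next
  case False
  have le: "y < x" if "y \<in> s" for y
    using assms(3) that False by (auto simp: height_le_iff less_le)
  have xs: "insert x s \<in> bar"
    using assms le by (auto simp: bar_iff less_imp_le)
  have "bd (\<epsilon> (insert x s)) = (sgn_pos (insert x s) x :: 'k) *s \<epsilon> s
      + (\<Sum>z\<in>s. sgn_pos (insert x s) z *s \<epsilon> (insert x s - {z}))"
    using False by (simp add: bd_unit_vec xs)
  also have "(sgn_pos (insert x s) x :: 'k) = (- 1) ^ card s"
  proof -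
    have "{y \<in> insert x s. y < x} = s" using le by auto
    then show ?thesis by (simp add: sgn_pos_def)
  qed
  also have "(\<Sum>z\<in>s. (sgn_pos (insert x s) z :: 'k) *s \<epsilon> (insert x s - {z})) =
      (\<Sum>z\<in>s. (sgn_pos s z :: 'k) *s \<epsilon> (insert x (s - {z})))"
  proof (rule sum.cong [OF refl])
    fix z assume z: "z \<in> s"
    have "{y \<in> insert x s. y < z} = {y \<in> s. y < z}" "insert x s - {z} = insert x (s - {z})"
      using le [OF z] z by auto
    then show "(sgn_pos (insert x s) z :: 'k) *s \<epsilon> (insert x s - {z}) = sgn_pos s z *s \<epsilon> (insert x (s - {z}))"
      by (simp add: sgn_pos_def)
  qed
  finally have 1: "bd (cone x (\<epsilon> s)) = \<epsilon> s
      + (\<Sum>z\<in>s. ((- 1) ^ card s * sgn_pos s z :: 'k) *s \<epsilon> (insert x (s - {z})))"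
    using False
    by (simp add: cone_def lin_scale [OF lin_bd] vec.scale_right_distrib vec.scale_sum_right
        vec.scale_scale flip: power_add mult_2)
  have "cone x (bd (\<epsilon> s)) = (\<Sum>z\<in>s. (sgn_pos s z :: 'k) *s cone x (\<epsilon> (s - {z})))"
    by (simp add: bd_unit_vec assms(2) lin_sum [OF lin_cone] lin_scale [OF lin_cone])
  also have "\<dots> = (\<Sum>z\<in>s. - (((- 1) ^ card s * sgn_pos s z :: 'k) *s \<epsilon> (insert x (s - {z}))))"
  proof (rule sum.cong [OF refl])
    fix z assume z: "z \<in> s"
    have "card s = Suc (card (s - {z}))"
      by (rule card_Suc_Diff1 [symmetric]) (use z in simp_all)
    then show "(sgn_pos s z :: 'k) *s cone x (\<epsilon> (s - {z})) =
        - (((- 1) ^ card s * sgn_pos s z :: 'k) *s \<epsilon> (insert x (s - {z})))"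
      using False by (simp add: cone_def vec.scale_scale mult.commute del: card_Diff_insert)
  qed
  finally show ?thesis
    by (simp add: 1 sum_negf)
qed

lemma cone_below:
  assumes "x \<noteq> bot" "v \<in> supported {s \<in> bar. height s \<le> x}"
  shows "cone x v \<in> supported {s \<in> bar. height s \<le> x}"
  by (rule supported_image [OF lin_cone assms(2)])
    (use assms(1) in \<open>auto simp: cone_def bar_iff height_le_iff intro!: supported_scale\<close>)

lemma filtered_complex_bar: "filtered_complex bar card height bd {}"
  by (rule filtered_complex.intro)
    (simp_all add: lin_bd bd_unit_vec_supported bd_bd height_eq_bot_iff)

lemma contractible_complex_bar:
  "contractible_complex (bar :: 'a::{finite, bounded_lattice_bot} set set) card height
     (bd :: 'k::field ^ ('a set) \<Rightarrow> _) {} cone"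
proof (intro contractible_complex.intro contractible_complex_axioms.intro filtered_complex_bar)
  fix x :: 'a and v :: "'k ^ ('a set)"
  assume x: "x \<noteq> bot" and v: "v \<in> supported {s \<in> bar. height s \<le> x}"
  show "bd (cone x v) + cone x (bd v) = v"
    by (rule lin_eq_on_supported [OF lin_plus [OF lin_comp [OF lin_bd lin_cone]
            lin_comp [OF lin_cone lin_bd]] lin_ident v])
      (simp add: bd_cone_unit_vec x)
qed (simp_all add: lin_cone cone_below)

section \<open>Tensor products and Koszul signs\<close>

definition tensor :: "'k::field ^ 'b::finite \<Rightarrow> 'k ^ 'c::finite \<Rightarrow> 'k ^ ('b \<times> 'c)" where
  "tensor u v = (\<chi> p. u $ fst p * v $ snd p)"

text \<open>No Koszul sign is built in; where one is wanted, \<open>parity\<close> stands in the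
  first factor.\<close>

definition tensor_map ::
    "('k::field ^ 'b::finite \<Rightarrow> 'k ^ 'd::finite) \<Rightarrow> ('k ^ 'c::finite \<Rightarrow> 'k ^ 'e::finite) \<Rightarrow>
     'k ^ ('b \<times> 'c) \<Rightarrow> 'k ^ ('d \<times> 'e)" where
  "tensor_map f g = lin_ext (\<lambda>(s, t). tensor (f (\<epsilon> s)) (g (\<epsilon> t)))"

lemma tensor_unit_vec: "tensor (\<epsilon> s) (\<epsilon> t) = \<epsilon> (s, t)"
  by (auto simp: tensor_def axis_def vec_eq_iff)

lemma lin_tensor_left: "lin (\<lambda>u. tensor u v)"
  and lin_tensor_right: "lin (\<lambda>v. tensor u v)"
  by (simp_all add: lin_iff tensor_def vec_eq_iff algebra_simps)

lemma tensor_add_left: "tensor (u + u') v = tensor u v + tensor u' v"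
  and tensor_uminus_left: "tensor (- u) v = - tensor u v"
  and tensor_zero_left: "tensor 0 v = 0"
  and tensor_zero_right: "tensor u 0 = 0"
  by (simp_all add: tensor_def vec_eq_iff algebra_simps)

lemma lin_tensor_map: "lin (tensor_map f g)"
  by (simp add: tensor_map_def lin_lin_ext)

lemma tensor_map_tensor:
  assumes f: "lin f" and g: "lin g"
  shows "tensor_map f g (tensor u v) = tensor (f u) (g v)"
proof -
  have *: "tensor_map f g (tensor (\<epsilon> s) v) = tensor (f (\<epsilon> s)) (g v)" for s
    by (rule lin_eqI [OF lin_comp [OF lin_tensor_map lin_tensor_right] lin_comp [OF lin_tensor_right g]])
      (simp add: tensor_unit_vec, simp add: tensor_map_def)
  show ?thesis
    by (rule lin_eqI [OF lin_comp [OF lin_tensor_map lin_tensor_left] lin_comp [OF lin_tensor_left f]])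
      (rule *)
qed

lemma lin_eq_on_tensors:
  assumes "lin f" "lin g" "\<And>s t. f (tensor (\<epsilon> s) (\<epsilon> t)) = g (tensor (\<epsilon> s) (\<epsilon> t))"
  shows "f w = g w"
  by (rule lin_eqI [OF assms(1,2)]) (use assms(3) in \<open>auto simp: tensor_unit_vec\<close>)

lemma tensor_supported:
  assumes "u \<in> supported X" "v \<in> supported Y"
  shows "tensor u v \<in> supported (X \<times> Y)"
  using assms by (auto simp: supported_def tensor_def)

definition parity :: "'k::field ^ ('a::finite set) \<Rightarrow> 'k ^ ('a set)" where
  "parity = lin_ext (\<lambda>s. (- 1) ^ card s *s \<epsilon> s)"

lemma lin_parity: "lin parity"
  and parity_unit_vec: "parity (\<epsilon> s) = (- 1) ^ card s *s \<epsilon> s"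
  by (simp_all add: parity_def lin_lin_ext)

lemma parity_homogeneous:
  assumes "v \<in> supported {s. card s = n}"
  shows "parity v = (- 1) ^ n *s v"
  by (rule lin_eq_on_supported [OF lin_parity _ assms])
    (simp_all add: parity_unit_vec lin_iff vec.scale_right_distrib mult.commute)

text \<open>The degree may rise on some generators and fall on others; its parity changes in either
  case.\<close>

lemma parity_anticommute:
  assumes "lin f" "\<And>s. f (\<epsilon> s) \<in> supported {t. card t = Suc (card s)} \<or>
    f (\<epsilon> s) \<in> supported {t. Suc (card t) = card s}"
  shows "parity (f v) = - f (parity v)"
proof -
  have unit: "parity (f (\<epsilon> s)) + f (parity (\<epsilon> s)) = 0" for s
  proof -
    consider "f (\<epsilon> s) \<in> supported {t. card t = Suc (card s)}"
      | n where "card s = Suc n" "f (\<epsilon> s) \<in> supported {t. card t = n}"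
      | "f (\<epsilon> s) \<in> supported {}"
      using assms(2) [of s] by (cases "card s") auto
    then show ?thesis
    proof cases
      case 3
      then have "f (\<epsilon> s) = 0" by (simp add: supported_def vec_eq_iff)
      then show ?thesis
        by (simp add: parity_unit_vec lin_scale [OF assms(1)] lin_zero [OF lin_parity])
    qed (simp_all add: parity_homogeneous parity_unit_vec lin_scale [OF assms(1)] lin_uminus [OF assms(1)])
  qed
  have "parity (f v) + f (parity v) = 0"
    by (rule lin_eqI [OF lin_plus [OF lin_comp [OF lin_parity assms(1)]
            lin_comp [OF assms(1) lin_parity]] lin_null]) (rule unit)
  then show ?thesis by (simp add: eq_neg_iff_add_eq_0)
qed

lemma parity_commute:
  assumes "lin f" "\<And>s. f (\<epsilon> s) \<in> supported {t. card t = card s}"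
  shows "parity (f v) = f (parity v)"
  by (rule lin_eqI [OF lin_comp [OF lin_parity assms(1)] lin_comp [OF assms(1) lin_parity]])
    (simp add: parity_homogeneous [OF assms(2)] parity_unit_vec lin_scale [OF assms(1)])

lemma parity_bd:
  fixes v :: "'k::field ^ ('a::{finite, bounded_lattice_bot} set)"
  shows "parity (bd v) = - bd (parity v)"
proof (rule parity_anticommute [OF lin_bd])
  fix s :: "'a set"
  show "bd (\<epsilon> s) \<in> supported {t. card t = Suc (card s)} \<or>
      (bd (\<epsilon> s) :: 'k ^ _) \<in> supported {t. Suc (card t) = card s}"
    by (cases "s \<in> bar")
      (auto simp: bd_unit_vec_outside intro!: subsetD [OF supported_mono bd_unit_vec_supported])
qed

lemma parity_cone:
  fixes v :: "'k::field ^ ('a::{finite, bounded_lattice_bot} set)"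
  shows "parity (cone x v) = - cone x (parity v)"
proof (rule parity_anticommute [OF lin_cone])
  fix s :: "'a set"
  show "cone x (\<epsilon> s) \<in> supported {t. card t = Suc (card s)} \<or>
      (cone x (\<epsilon> s) :: 'k ^ _) \<in> supported {t. Suc (card t) = card s}"
    by (auto simp: cone_def intro!: supported_scale)
qed

section \<open>The tensor square of the bar resolution\<close>

definition bd2 :: "'k::field ^ ('a::{finite, bounded_lattice_bot} set \<times> 'a set) \<Rightarrow> 'k ^ ('a set \<times> 'a set)" where
  "bd2 w = tensor_map bd (\<lambda>v. v) w + tensor_map parity bd w"

abbreviation card2 :: "'a set \<times> 'a set \<Rightarrow> nat" where
  "card2 \<equiv> \<lambda>(s, t). card s + card t"

text \<open>A join lies at or below x exactly when both factors do, so the value of the square at x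
  is the tensor product of the two values at x. This is where the lattice structure enters.\<close>

abbreviation height2 :: "'a set \<times> 'a set \<Rightarrow> 'a::{finite, bounded_lattice_bot}" where
  "height2 \<equiv> \<lambda>(s, t). sup (height s) (height t)"

lemma lin_bd2: "lin bd2"
  unfolding bd2_def [abs_def] by (intro lin_plus lin_tensor_map)

lemma bd2_tensor: "bd2 (tensor u v) = tensor (bd u) v + tensor (parity u) (bd v)"
  by (simp add: bd2_def tensor_map_tensor lin_bd lin_ident lin_parity)

text \<open>The two mixed terms cancel because \<open>parity\<close> anticommutes with
  \<open>bd\<close>.\<close>

lemma bd2_bd2: "bd2 (bd2 w) = 0"
  by (rule lin_eq_on_tensors [OF lin_comp [OF lin_bd2 lin_bd2] lin_null])
    (simp add: bd2_tensor lin_add [OF lin_bd2] bd_bd tensor_zero_left tensor_zero_right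
      parity_bd tensor_uminus_left)

lemma bd2_unit_vec_supported:
  assumes "s \<in> bar" "t \<in> bar"
  shows "bd2 (\<epsilon> (s, t)) \<in> supported
    ({s' \<in> bar. Suc (card s') = card s \<and> height s' \<le> height s} \<times> {t} \<union>
     {s} \<times> {t' \<in> bar. Suc (card t') = card t \<and> height t' \<le> height t})"
  unfolding tensor_unit_vec [symmetric] bd2_tensor
proof (rule supported_add)
  have "tensor (bd (\<epsilon> s)) (\<epsilon> t) \<in> supported
     ({s' \<in> bar. Suc (card s') = card s \<and> height s' \<le> height s} \<times> {t})"
    by (rule tensor_supported [OF bd_unit_vec_supported [OF assms(1)]]) simp
  then show "tensor (bd (\<epsilon> s)) (\<epsilon> t) \<in> supported
    ({s' \<in> bar. Suc (card s') = card s \<and> height s' \<le> height s} \<times> {t} \<union>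
     {s} \<times> {t' \<in> bar. Suc (card t') = card t \<and> height t' \<le> height t})"
    by (rule subsetD [OF supported_mono, rotated]) blast
  have "tensor (parity (\<epsilon> s)) (bd (\<epsilon> t)) \<in> supported
     ({s} \<times> {t' \<in> bar. Suc (card t') = card t \<and> height t' \<le> height t})"
    by (rule tensor_supported [OF _ bd_unit_vec_supported [OF assms(2)]])
      (simp add: parity_unit_vec supported_scale)
  then show "tensor (parity (\<epsilon> s)) (bd (\<epsilon> t)) \<in> supported
    ({s' \<in> bar. Suc (card s') = card s \<and> height s' \<le> height s} \<times> {t} \<union>
     {s} \<times> {t' \<in> bar. Suc (card t') = card t \<and> height t' \<le> height t})"
    by (rule subsetD [OF supported_mono, rotated]) blast
qed

lemma filtered_complex_bar2:
  "filtered_complex (bar \<times> bar) card2 height2 bd2 ({}, {})"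
proof (rule filtered_complex.intro)
  fix b :: "'a set \<times> 'a set" assume b: "b \<in> bar \<times> bar"
  obtain s t where st: "b = (s, t)" by (cases b)
  show "bd2 (\<epsilon> b) \<in> supported {c \<in> bar \<times> bar. Suc (card2 c) = card2 b \<and> height2 c \<le> height2 b}"
    using b unfolding st
    by (intro subsetD [OF supported_mono bd2_unit_vec_supported]) (auto intro: le_supI1 le_supI2)
  show "card2 b = 0 \<longleftrightarrow> b = ({}, {})"
    by (simp add: st)
  show "height2 b = bot \<longleftrightarrow> b = ({}, {})"
    using b by (simp add: st height_eq_bot_iff)
qed (simp_all add: lin_bd2 bd2_bd2)

text \<open>Contracting the first factor suffices: the terms with \<open>bd\<close> in the second
  factor cancel, since \<open>parity\<close> anticommutes with \<open>cone x\<close>, and the others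
  give the contraction identity of the first factor.\<close>

lemma contractible_complex_bar2:
  "contractible_complex (bar \<times> bar :: ('a::{finite, bounded_lattice_bot} set \<times> 'a set) set) card2 height2
    (bd2 :: 'k::field ^ ('a set \<times> 'a set) \<Rightarrow> _) ({}, {}) (\<lambda>x. tensor_map (cone x) (\<lambda>v. v))"
proof (intro contractible_complex.intro contractible_complex_axioms.intro filtered_complex_bar2)
  fix x :: 'a and v :: "'k ^ ('a set \<times> 'a set)"
  assume x: "x \<noteq> bot" and v: "v \<in> supported {b \<in> bar \<times> bar. height2 b \<le> x}"
  show "tensor_map (cone x) (\<lambda>v. v) v \<in> supported {b \<in> bar \<times> bar. height2 b \<le> x}"
  proof (rule supported_image [OF lin_tensor_map v])
    fix b :: "'a set \<times> 'a set" assume "b \<in> {b \<in> bar \<times> bar. height2 b \<le> x}"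
    then obtain s t where st: "b = (s, t)" "s \<in> bar" "t \<in> bar" "height s \<le> x" "height t \<le> x"
      by (cases b) auto
    have "tensor (cone x (\<epsilon> s)) (\<epsilon> t :: 'k ^ _) \<in> supported ({s \<in> bar. height s \<le> x} \<times> {t \<in> bar. height t \<le> x})"
      by (rule tensor_supported [OF cone_below [OF x]]) (simp_all add: st)
    then show "tensor_map (cone x) (\<lambda>v. v) (\<epsilon> b :: 'k ^ _) \<in> supported {b \<in> bar \<times> bar. height2 b \<le> x}"
      unfolding st tensor_unit_vec [symmetric] tensor_map_tensor [OF lin_cone lin_ident]
      by (rule subsetD [OF supported_mono, rotated]) auto
  qed
  show "bd2 (tensor_map (cone x) (\<lambda>v. v) v) + tensor_map (cone x) (\<lambda>v. v) (bd2 v) = v"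
  proof (rule lin_eq_on_supported [OF lin_plus [OF lin_comp [OF lin_bd2 lin_tensor_map]
            lin_comp [OF lin_tensor_map lin_bd2]] lin_ident v])
    fix b :: "'a set \<times> 'a set" assume "b \<in> {b \<in> bar \<times> bar. height2 b \<le> x}"
    then obtain s t where st: "b = (s, t)" "s \<in> bar" "height s \<le> x"
      by (cases b) auto
    show "bd2 (tensor_map (cone x) (\<lambda>v. v) (\<epsilon> b)) + tensor_map (cone x) (\<lambda>v. v) (bd2 (\<epsilon> b)) = (\<epsilon> b :: 'k ^ _)"
      unfolding st(1) tensor_unit_vec [symmetric] tensor_map_tensor [OF lin_cone lin_ident] bd2_tensor
        lin_add [OF lin_tensor_map]
      by (simp add: parity_cone tensor_uminus_left bd_cone_unit_vec [OF x st(2,3)] flip: tensor_add_left)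
  qed
qed (rule lin_tensor_map)

section \<open>Removing generators at acyclic positions\<close>

text \<open>Vanishing of $\beta_a(x)$: exactness in degree $a$ of $F(x)$ modulo the part strictly below $x$.\<close>

definition acyclic_at :: "'k::field itself \<Rightarrow> nat \<Rightarrow> 'a::{finite, bounded_lattice_bot} \<Rightarrow> bool" where
  "acyclic_at _ a x \<longleftrightarrow>
    (\<forall>c :: 'k ^ ('a set) \<in> supported {s \<in> bar. card s = a \<and> height s \<le> x}.
       bd c \<in> supported {s \<in> bar. height s < x} \<longrightarrow>
       (\<exists>e \<in> supported {s \<in> bar. card s = Suc a \<and> height s \<le> x}.
          c - bd e \<in> supported {s \<in> bar. height s < x}))"

lemma bd_supported:
  assumes "v \<in> supported X" "X \<subseteq> bar"
    "\<And>s t. s \<in> X \<Longrightarrow> t \<in> bar \<Longrightarrow> Suc (card t) = card s \<Longrightarrow> height t \<le> height s \<Longrightarrow> t \<in> Y"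
  shows "bd v \<in> supported Y"
proof (rule supported_image [OF lin_bd assms(1)])
  fix s assume "s \<in> X"
  then show "bd (\<epsilon> s) \<in> supported Y"
    using assms(2,3) by (intro subsetD [OF supported_mono bd_unit_vec_supported]) auto
qed

lemma exact_splitting:
  fixes d :: "'k::field ^ 'b::finite \<Rightarrow> 'k ^ 'b"
  assumes d: "lin d" and U: "vec.subspace U" and V: "vec.subspace V"
    and exact: "\<And>v. v \<in> V \<Longrightarrow> d v = 0 \<Longrightarrow> \<exists>u\<in>U. d u = v"
  shows "\<exists>h0 h1. lin h0 \<and> lin h1 \<and> range h0 \<subseteq> V \<and> range h1 \<subseteq> U \<and> (\<forall>v\<in>V. d (h1 v) + h0 (d v) = v)"
proof -
  obtain h0 where h0: "range h0 \<subseteq> V" "lin h0" "\<forall>v\<in>d ` V. d (h0 v) = v"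
    using vec.linear_exists_right_inverse_on [OF d V] by blast
  obtain h where h: "range h \<subseteq> U" "lin h" "\<forall>v\<in>d ` U. d (h v) = v"
    using vec.linear_exists_right_inverse_on [OF d U] by blast
  define h1 where "h1 v = h (v - h0 (d v))" for v
  have "lin h1"
    unfolding h1_def by (rule lin_comp [OF h(2) lin_minus [OF lin_ident lin_comp [OF h0(2) d]]])
  moreover have "d (h1 v) + h0 (d v) = v" if "v \<in> V" for v
  proof -
    have "v - h0 (d v) \<in> V"
      using that h0(1) by (intro vec.subspace_diff [OF V]) auto
    moreover have "d (v - h0 (d v)) = 0"
      using that h0(3) by (simp add: lin_diff [OF d])
    ultimately have "v - h0 (d v) \<in> d ` U"
      using exact by force
    then have "d (h (v - h0 (d v))) = v - h0 (d v)"
      using h(3) by blast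
    then show ?thesis
      by (simp add: h1_def)
  qed
  moreover have "range h1 \<subseteq> U"
    using h(1) by (auto simp: h1_def)
  ultimately show ?thesis
    using h0 by blast
qed

text \<open>The quotient of F(x) by its part strictly below \<open>x\<close> has the chains with top
  exactly \<open>x\<close> as basis, and \<open>P\<close> is its differential. So \<open>h0\<close>
  leads into degree \<open>a\<close>, \<open>h1\<close> into degree a + 1, and together they
  contract the quotient in degree \<open>a\<close>.\<close>

lemma acyclic_at_splitting:
  fixes x :: "'a::{finite, bounded_lattice_bot}"
  defines "P \<equiv> \<lambda>v. proj {s. height s = x} (bd v)"
  assumes "acyclic_at TYPE('k::field) a x"
  shows "\<exists>h0 h1 :: 'k ^ ('a set) \<Rightarrow> 'k ^ ('a set). lin h0 \<and> lin h1 \<and>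
    range h0 \<subseteq> supported {s \<in> bar. card s = a \<and> height s = x} \<and>
    range h1 \<subseteq> supported {s \<in> bar. card s = Suc a \<and> height s = x} \<and>
    (\<forall>v\<in>supported {s \<in> bar. card s = a \<and> height s = x}. P (h1 v) + h0 (P v) = v)"
proof (rule exact_splitting [OF _ subspace_supported subspace_supported])
  show lin_P: "lin P"
    unfolding P_def by (rule lin_comp [OF lin_proj lin_bd])
  fix v :: "'k ^ ('a set)"
  assume v: "v \<in> supported {s \<in> bar. card s = a \<and> height s = x}" and Pv: "P v = 0"
  have bd_le: "bd w \<in> supported {s \<in> bar. height s \<le> x}" if "w \<in> supported {s \<in> bar. height s \<le> x}"
    for w :: "'k ^ ('a set)"
    using that by (rule bd_supported) auto
  have bd_less: "bd w \<in> supported {s \<in> bar. height s < x}" if "w \<in> supported {s \<in> bar. height s < x}"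
    for w :: "'k ^ ('a set)"
    using that by (rule bd_supported) auto
  have drop: "w - proj {s. height s = x} w \<in> supported {s \<in> bar. height s < x}"
    if "w \<in> supported {s \<in> bar. height s \<le> x}" for w :: "'k ^ ('a set)"
    using that by (auto simp: supported_def proj_def less_le)
  have kill: "proj {s. height s = x} w = 0" if "w \<in> supported {s \<in> bar. height s < x}"
    for w :: "'k ^ ('a set)"
    using that by (intro proj_eq_0) (auto simp: supported_def)
  have "v \<in> supported {s \<in> bar. height s \<le> x}"
    using v by (auto simp: supported_def)
  then have "bd v \<in> supported {s \<in> bar. height s < x}"
    using drop [OF bd_le] Pv by (force simp: P_def)
  moreover have "v \<in> supported {s \<in> bar. card s = a \<and> height s \<le> x}"
    using v by (auto simp: supported_def)
  ultimately obtain e where e: "e \<in> supported {s \<in> bar. card s = Suc a \<and> height s \<le> x}"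
    "v - bd e \<in> supported {s \<in> bar. height s < x}"
    using assms(2) unfolding acyclic_at_def by blast
  \<comment> \<open>What is cut off lies strictly below \<open>x\<close>, and so does its boundary;
    hence \<open>P\<close> is unchanged.\<close>
  define u where "u = proj {s. height s = x} e"
  have "e \<in> supported {s \<in> bar. height s \<le> x}"
    using e(1) by (auto simp: supported_def)
  then have "bd (e - u) \<in> supported {s \<in> bar. height s < x}"
    unfolding u_def by (intro bd_less drop)
  then have "P e - P u = 0"
    unfolding P_def lin_diff [OF lin_proj, symmetric] lin_diff [OF lin_bd, symmetric] by (rule kill)
  moreover have "proj {s. height s = x} v = P e"
    using kill [OF e(2)] by (simp add: P_def lin_diff [OF lin_proj])
  moreover have "proj {s. height s = x} v = v"
    using v by (intro proj_ident) (auto simp: supported_def)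
  ultimately have "P u = v" by simp
  moreover have "u \<in> supported {s \<in> bar. card s = Suc a \<and> height s = x}"
    using e(1) by (auto simp: u_def supported_def proj_def)
  ultimately show "\<exists>u\<in>supported {s \<in> bar. card s = Suc a \<and> height s = x}. P u = v" by blast
qed

text \<open>The map is $e = 1 - \partial h - h \partial$, where $h$ is assembled from contractions of the
  associated graded complex in degree $a$ at the acyclic positions.\<close>

lemma deflation_step:
  fixes a :: nat
  shows "\<exists>e :: 'k::field ^ ('a set) \<Rightarrow> 'k ^ ('a::{finite, bounded_lattice_bot} set).
    lin e \<and> (\<forall>v. bd (e v) = e (bd v)) \<and> e (\<epsilon> {}) = \<epsilon> {} \<and>
    (\<forall>s. e (\<epsilon> s) \<in> supported {t. card t = card s}) \<and>
    (\<forall>s\<in>bar. e (\<epsilon> s) \<in> supported {t \<in> bar. height t \<le> height s}) \<and>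
    (\<forall>s\<in>bar. card s = a \<longrightarrow> acyclic_at TYPE('k) a (height s) \<longrightarrow>
      e (\<epsilon> s) \<in> supported {t \<in> bar. card t = a \<and> height t < height s})"
proof -
  define A where "A = {x :: 'a. \<not> acyclic_at TYPE('k) a x}"
  let ?P = "\<lambda>x v. proj {s. height s = x} (bd v)"
  define splits where "splits x h0 h1 \<longleftrightarrow> lin h0 \<and> lin h1 \<and>
    range h0 \<subseteq> supported {s \<in> bar. card s = a \<and> height s = x} \<and>
    range h1 \<subseteq> supported {s \<in> bar. card s = Suc a \<and> height s = x} \<and>
    (\<forall>v\<in>supported {s \<in> bar. card s = a \<and> height s = x}. ?P x (h1 v) + h0 (?P x v) = v)"
    for x and h0 h1 :: "'k ^ ('a set) \<Rightarrow> 'k ^ ('a set)"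
  have "\<exists>h0 h1. splits x h0 h1" if "x \<notin> A" for x
    using that unfolding A_def splits_def by (intro acyclic_at_splitting) simp
  then obtain h0 h1 where sp: "\<And>x. x \<notin> A \<Longrightarrow> splits x (h0 x) (h1 x)"
    by metis
  have lin_h0: "lin (h0 x)" if "x \<notin> A" for x
    using sp [OF that] by (simp add: splits_def)
  have h0: "h0 x v \<in> supported {s \<in> bar. card s = a \<and> height s = x}" if "x \<notin> A" for x v
    using sp [OF that] by (auto simp: splits_def)
  have h1: "h1 x v \<in> supported {s \<in> bar. card s = Suc a \<and> height s = x}" if "x \<notin> A" for x v
    using sp [OF that] by (auto simp: splits_def)
  have split: "?P x (h1 x v) + h0 x (?P x v) = v"
    if "x \<notin> A" "v \<in> supported {s \<in> bar. card s = a \<and> height s = x}" for x v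
    using sp [OF that(1)] that(2) by (simp add: splits_def)
  \<comment> \<open>On a generator of degree \<open>a\<close>, the term \<open>bd \<circ> h\<close>
    sees \<open>h1\<close> and the term \<open>h \<circ> bd\<close> sees \<open>h0\<close>, so both
    degrees a - 1 and \<open>a\<close> are needed.\<close>
  define h where "h = lin_ext (\<lambda>s. if s \<notin> bar \<or> height s \<in> A then 0
    else if Suc (card s) = a then h0 (height s) (\<epsilon> s)
    else if card s = a then h1 (height s) (\<epsilon> s) else 0)"
  have lin_h: "lin h" by (simp add: h_def lin_lin_ext)
  have h_unit_vec: "h (\<epsilon> s) = (if s \<notin> bar \<or> height s \<in> A then 0
    else if Suc (card s) = a then h0 (height s) (\<epsilon> s)
    else if card s = a then h1 (height s) (\<epsilon> s) else 0)" for s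
    by (simp add: h_def)
  have h_supported: "h (\<epsilon> s) \<in> supported {t \<in> bar. card t = Suc (card s) \<and> height t = height s}" for s
    using h0 h1 by (auto simp: h_unit_vec)
  define e where "e v = v - bd (h v) - h (bd v)" for v
  have lin_e: "lin e"
    unfolding e_def
    by (rule lin_minus [OF lin_minus [OF lin_ident lin_comp [OF lin_bd lin_h]] lin_comp [OF lin_h lin_bd]])
  have bd_h: "bd (h (\<epsilon> s)) \<in> supported {t \<in> bar. card t = card s \<and> height t \<le> height s}" for s
    by (rule bd_supported [OF h_supported]) auto
  have h_bd: "h (bd (\<epsilon> s)) \<in> supported {t \<in> bar. card t = card s \<and> height t \<le> height s}" if "s \<in> bar" for s
    by (rule supported_image [OF lin_h bd_unit_vec_supported [OF that]])
      (auto intro: subsetD [OF supported_mono h_supported])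
  have e_bar: "e (\<epsilon> s) \<in> supported {t \<in> bar. card t = card s \<and> height t \<le> height s}" if "s \<in> bar" for s
    unfolding e_def using that by (intro supported_diff bd_h h_bd) auto
  \<comment> \<open>Degree preservation is claimed for all sets, because
    \<open>parity_commute\<close> asks for it; off \<open>bar\<close> the map is the
    identity.\<close>
  have e_outside: "e (\<epsilon> s) = \<epsilon> s" if "s \<notin> bar" for s
    using that by (simp add: e_def h_unit_vec bd_unit_vec_outside lin_zero [OF lin_bd] lin_zero [OF lin_h])
  show ?thesis
  proof (intro exI [of _ e] conjI allI ballI impI)
    show "lin e" by (rule lin_e)
    \<comment> \<open>Both sides are \<open>bd v - bd (h (bd v))\<close>.\<close>
    show "bd (e v) = e (bd v)" for v
      by (simp add: e_def lin_diff [OF lin_bd] bd_bd lin_zero [OF lin_h])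
    \<comment> \<open>\<open>h\<close> keeps the position and raises the degree, but no nonempty
      chain sits at \<open>bot\<close>.\<close>
    have "h (\<epsilon> {}) = 0"
    proof -
      have "{t \<in> bar. card t = Suc (card ({} :: 'a set)) \<and> height t = height ({} :: 'a set)} = {}"
        by (auto simp: height_eq_bot_iff)
      then show ?thesis
        using h_supported [of "{}"] by (auto simp: supported_def vec_eq_iff)
    qed
    then show "e (\<epsilon> {}) = \<epsilon> {}"
      by (simp add: e_def bd_unit_vec lin_zero [OF lin_bd] lin_zero [OF lin_h])
    show "e (\<epsilon> s) \<in> supported {t. card t = card s}" for s
      by (cases "s \<in> bar") (auto simp: e_outside intro: subsetD [OF supported_mono e_bar])
    show "e (\<epsilon> s) \<in> supported {t \<in> bar. height t \<le> height s}" if "s \<in> bar" for s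
      using that by (intro subsetD [OF supported_mono e_bar]) auto
  next
    fix s :: "'a set" assume s: "s \<in> bar" "card s = a" "acyclic_at TYPE('k) a (height s)"
    obtain x where x: "height s = x" by simp
    with s have xA: "x \<notin> A" by (simp add: A_def)
    have P_s: "?P x (\<epsilon> s :: 'k ^ _) \<in> supported {t \<in> bar. Suc (card t) = a \<and> height t = x}"
      using bd_unit_vec_supported [OF s(1)] by (auto simp: supported_def proj_def s)
    \<comment> \<open>Faces that lose the top \<open>x\<close> stay strictly below \<open>x\<close>
      under \<open>h\<close>, so only \<open>?P x\<close> contributes to the part of
      \<open>e (\<epsilon> s)\<close> with top \<open>x\<close>. That part vanishes by the splitting
      identity.\<close>
    have "bd (\<epsilon> s) - ?P x (\<epsilon> s) \<in> supported {t \<in> bar. height t < x}"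
      using bd_unit_vec_supported [OF s(1)] by (auto simp: supported_def proj_def x less_le)
    then have "h (bd (\<epsilon> s) - ?P x (\<epsilon> s)) \<in> supported {t. height t < x}"
      by (rule supported_image [OF lin_h]) (auto intro: subsetD [OF supported_mono h_supported])
    then have "proj {t. height t = x} (h (bd (\<epsilon> s) - ?P x (\<epsilon> s))) = 0"
      by (intro proj_eq_0) (auto simp: supported_def)
    then have "proj {t. height t = x} (h (bd (\<epsilon> s))) = proj {t. height t = x} (h (?P x (\<epsilon> s)))"
      by (simp add: lin_diff [OF lin_h] lin_diff [OF lin_proj])
    also have "h (?P x (\<epsilon> s)) = h0 x (?P x (\<epsilon> s))"
      by (rule lin_eq_on_supported [OF lin_h lin_h0 [OF xA] P_s]) (auto simp: h_unit_vec xA)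
    also have "proj {t. height t = x} (h0 x (?P x (\<epsilon> s))) = h0 x (?P x (\<epsilon> s))"
      using h0 [OF xA, of "?P x (\<epsilon> s)"] by (intro proj_ident) (auto simp: supported_def)
    finally have "proj {t. height t = x} (e (\<epsilon> s)) = \<epsilon> s - ?P x (h1 x (\<epsilon> s)) - h0 x (?P x (\<epsilon> s))"
      using s xA by (simp add: e_def lin_diff [OF lin_proj] proj_unit_vec x h_unit_vec)
    also have "\<dots> = 0"
      using split [OF xA, of "\<epsilon> s"] s x by (simp add: algebra_simps)
    finally show "e (\<epsilon> s) \<in> supported {t \<in> bar. card t = a \<and> height t < height s}"
      using e_bar [OF s(1)] s(2) x
      by (auto simp: supported_def proj_def vec_eq_iff less_le) metis
  qed
qed

text \<open>Iterate the previous map. A generator of degree \<open>a\<close> at an acyclic position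
  moves strictly down at each application; once it is under a position that is not acyclic,
  naturality keeps it there. Strict descents stop because the poset is finite.\<close>

lemma deflation:
  fixes a :: nat
  shows "\<exists>e :: 'k::field ^ ('a set) \<Rightarrow> 'k ^ ('a::{finite, bounded_lattice_bot} set).
    lin e \<and> (\<forall>v. bd (e v) = e (bd v)) \<and> e (\<epsilon> {}) = \<epsilon> {} \<and>
    (\<forall>s. e (\<epsilon> s) \<in> supported {t. card t = card s}) \<and>
    (\<forall>s\<in>bar. e (\<epsilon> s) \<in> supported {t \<in> bar. height t \<le> height s}) \<and>
    (\<forall>s\<in>bar. card s = a \<longrightarrow>
      e (\<epsilon> s) \<in> supported {t \<in> bar. \<exists>y. \<not> acyclic_at TYPE('k) a y \<and> height t \<le> y \<and> y \<le> height s})"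
proof -
  obtain e :: "'k ^ ('a set) \<Rightarrow> 'k ^ ('a set)"
    where lin_e: "lin e" and comm: "\<forall>v. bd (e v) = e (bd v)" and base: "e (\<epsilon> {}) = \<epsilon> {}"
    and e_card: "\<forall>s. e (\<epsilon> s) \<in> supported {t. card t = card s}"
    and e_height: "\<forall>s\<in>bar. e (\<epsilon> s) \<in> supported {t \<in> bar. height t \<le> height s}"
    and e_less: "\<forall>s\<in>bar. card s = a \<longrightarrow> acyclic_at TYPE('k) a (height s) \<longrightarrow>
      e (\<epsilon> s) \<in> supported {t \<in> bar. card t = a \<and> height t < height s}"
    using deflation_step [where 'a = 'a and 'k = 'k, of a] by (elim exE conjE) (rule that)
  define A where "A = {x :: 'a. \<not> acyclic_at TYPE('k) a x}"
  define Q where "Q x = {t \<in> bar. card t = a \<and> (\<exists>y\<in>A. height t \<le> y \<and> y \<le> x)}" for x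
  have e_Q: "e v \<in> supported (Q x)" if "v \<in> supported (Q x)" for v x
  proof (rule supported_image [OF lin_e that])
    fix s assume s: "s \<in> Q x"
    have "card t = card s \<and> t \<in> bar \<and> height t \<le> height s" if "e (\<epsilon> s) $ t \<noteq> 0" for t
      using e_card [rule_format, of s] e_height [rule_format, of s] s that
      by (simp add: Q_def supported_def)
    with s show "e (\<epsilon> s) \<in> supported (Q x)"
      unfolding supported_def Q_def by (blast intro: order_trans)
  qed
  have iterate: "(e ^^ n) v \<in> supported X"
    if "v \<in> supported X" "\<And>s. s \<in> X \<Longrightarrow> e (\<epsilon> s) \<in> supported X" for n v X
    using that by (induction n) (auto intro: supported_image [OF lin_e])
  \<comment> \<open>The number of elements at or below the position bounds the number of descents.
    It is never 0, as the position itself counts.\<close>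
  have Q: "(e ^^ n) (\<epsilon> s) \<in> supported (Q (height s))"
    if "s \<in> bar" "card s = a" "card {y. y \<le> height s} \<le> n" for s n
    using that
  proof (induction n arbitrary: s)
    case 0
    then have "{y. y \<le> height s} = {}" by simp
    then show ?case by auto
  next
    case (Suc n)
    show ?case
    proof (cases "height s \<in> A")
      case True
      then have "\<epsilon> s \<in> supported (Q (height s))"
        using Suc.prems by (auto simp: Q_def)
      then show ?thesis
        by (rule iterate) (simp add: e_Q)
    next
      case False
      have "(e ^^ n) (e (\<epsilon> s)) \<in> supported (Q (height s))"
      proof (rule supported_image [OF lin_funpow [OF lin_e] e_less [rule_format, OF Suc.prems(1,2)]])
        show "acyclic_at TYPE('k) a (height s)" using False by (simp add: A_def)
      next
        fix t assume t: "t \<in> {t \<in> bar. card t = a \<and> height t < height s}"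
        have "card {y. y \<le> height t} < card {y. y \<le> height s}"
        proof (rule psubset_card_mono)
          have "{y. y \<le> height t} \<subseteq> {y. y \<le> height s}"
            using t by (auto intro: order_trans less_imp_le)
          moreover have "height s \<in> {y. y \<le> height s} - {y. y \<le> height t}"
            using t by (auto dest: leD)
          ultimately show "{y. y \<le> height t} \<subset> {y. y \<le> height s}"
            by blast
        qed simp
        then have "(e ^^ n) (\<epsilon> t) \<in> supported (Q (height t))"
          using t Suc.prems by (intro Suc.IH) auto
        moreover have "Q (height t) \<subseteq> Q (height s)"
          using t by (auto simp: Q_def intro: order_trans less_imp_le)
        ultimately show "(e ^^ n) (\<epsilon> t) \<in> supported (Q (height s))"
          using supported_mono by blast
      qed
      then show ?thesis by (simp add: funpow_swap1)
    qed
  qed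
  define N where "N = card (UNIV :: 'a set)"
  show ?thesis
  proof (intro exI [of _ "e ^^ N"] conjI allI ballI impI)
    show "lin (e ^^ N)" by (rule lin_funpow [OF lin_e])
    show "bd ((e ^^ N) v) = (e ^^ N) (bd v)" for v
      by (induction N) (simp_all add: comm)
    show "(e ^^ N) (\<epsilon> {}) = \<epsilon> {}"
      by (induction N) (simp_all add: base)
    show "(e ^^ N) (\<epsilon> s) \<in> supported {t. card t = card s}" for s
    proof (rule iterate)
      fix t :: "'a set" assume "t \<in> {t. card t = card s}"
      then show "e (\<epsilon> t) \<in> supported {t. card t = card s}"
        using e_card [rule_format, of t] by simp
    qed simp
    show "(e ^^ N) (\<epsilon> s) \<in> supported {t \<in> bar. height t \<le> height s}" if "s \<in> bar" for s
    proof (rule iterate)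
      fix t assume "t \<in> {t \<in> bar. height t \<le> height s}"
      then show "e (\<epsilon> t) \<in> supported {t \<in> bar. height t \<le> height s}"
        by (intro subsetD [OF supported_mono e_height [rule_format]]) auto
    qed (use that in auto)
    show "(e ^^ N) (\<epsilon> s) \<in> supported {t \<in> bar. \<exists>y. \<not> acyclic_at TYPE('k) a y \<and> height t \<le> y \<and> y \<le> height s}"
      if "s \<in> bar" "card s = a" for s
      by (rule subsetD [OF supported_mono Q [OF that]]) (auto simp: Q_def N_def A_def intro: card_mono)
  qed
qed

section \<open>Vanishing at a join\<close>

lemma bd_empty: "bd (\<epsilon> {}) = 0"
  by (simp add: bd_unit_vec)

text \<open>\<open>bd\<close> lowers the cardinality of every chain by exactly one.\<close>

lemma bd_proj_card:
  fixes v :: "'k::field ^ ('a::{finite, bounded_lattice_bot} set)"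
  assumes "v \<in> supported bar"
  shows "bd (proj {s. card s = Suc n} v) = proj {s. card s = n} (bd v)"
proof (rule lin_eq_on_supported [OF lin_comp [OF lin_bd lin_proj] lin_comp [OF lin_proj lin_bd] assms])
  fix s :: "'a set" assume s: "s \<in> bar"
  have sup: "bd (\<epsilon> s :: 'k ^ _) \<in> supported {t. Suc (card t) = card s}"
    by (rule subsetD [OF supported_mono bd_unit_vec_supported [OF s]]) auto
  show "bd (proj {s. card s = Suc n} (\<epsilon> s)) = proj {s. card s = n} (bd (\<epsilon> s) :: 'k ^ _)"
  proof (cases "card s = Suc n")
    case True
    with sup have "proj {s. card s = n} (bd (\<epsilon> s)) = (bd (\<epsilon> s) :: 'k ^ _)"
      by (intro proj_ident) simp
    with True show ?thesis by (simp add: proj_unit_vec)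
  next
    case False
    then have "proj {s. card s = n} (bd (\<epsilon> s)) = (0 :: 'k ^ _)"
      by (intro proj_eq_0 subsetD [OF supported_mono sup]) auto
    with False show ?thesis by (simp add: proj_unit_vec lin_zero [OF lin_bd])
  qed
qed

theorem acyclic_at_join:
  fixes m :: "'a::{finite, bounded_lattice_bot}"
  assumes ab: "a \<ge> 1" "b \<ge> 1"
    and join: "\<And>x y. sup x y = m \<Longrightarrow> acyclic_at TYPE('k::field) a x \<or> acyclic_at TYPE('k) b y"
  shows "acyclic_at TYPE('k) (a + b) m"
  unfolding acyclic_at_def
proof (intro ballI impI)
  fix c :: "'k ^ ('a set)"
  assume c: "c \<in> supported {s \<in> bar. card s = a + b \<and> height s \<le> m}"
    and bd_c: "bd c \<in> supported {s \<in> bar. height s < m}"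
  \<comment> \<open>Three comparisons: F to F for the homotopy \<open>l\<close>, F to its square for
    the homotopy \<open>k\<close>, and the square to F for the map \<open>r\<close>.\<close>
  interpret FF: complex_pair "bar :: 'a set set" card height "bd :: 'k ^ ('a set) \<Rightarrow> _" "{}"
    bar card height bd "{}" cone
    by (intro complex_pair.intro filtered_complex_bar contractible_complex_bar)
  interpret FT: complex_pair "bar :: 'a set set" card height "bd :: 'k ^ ('a set) \<Rightarrow> _" "{}"
    "bar \<times> bar" card2 height2 bd2 "({}, {})" "\<lambda>x. tensor_map (cone x) (\<lambda>v. v)"
    by (intro complex_pair.intro filtered_complex_bar contractible_complex_bar2)
  interpret TF: complex_pair "bar \<times> bar :: ('a set \<times> 'a set) set" card2 height2
    "bd2 :: 'k ^ ('a set \<times> 'a set) \<Rightarrow> _" "({}, {})" bar card height bd "{}" cone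
    by (intro complex_pair.intro filtered_complex_bar2 contractible_complex_bar)
  define Tle where "Tle = {p \<in> bar \<times> bar. height2 p \<le> m}"
  define Tlt where "Tlt = {p \<in> bar \<times> bar. height2 p < m}"

  obtain e :: "'k ^ ('a set) \<Rightarrow> 'k ^ ('a set)"
    where lin_e: "lin e" and e_bd: "\<forall>v. bd (e v) = e (bd v)" and e_empty: "e (\<epsilon> {}) = \<epsilon> {}"
      and e_card: "\<forall>s. e (\<epsilon> s) \<in> supported {t. card t = card s}"
      and e_height: "\<forall>s\<in>bar. e (\<epsilon> s) \<in> supported {t \<in> bar. height t \<le> height s}"
      and e_a: "\<forall>s\<in>bar. card s = a \<longrightarrow> e (\<epsilon> s) \<in>
        supported {t \<in> bar. \<exists>y. \<not> acyclic_at TYPE('k) a y \<and> height t \<le> y \<and> y \<le> height s}"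
    using deflation [where 'a = 'a and 'k = 'k, of a] by (elim exE conjE) (rule that)
  obtain e' :: "'k ^ ('a set) \<Rightarrow> 'k ^ ('a set)"
    where lin_e': "lin e'" and e'_bd: "\<forall>v. bd (e' v) = e' (bd v)" and e'_empty: "e' (\<epsilon> {}) = \<epsilon> {}"
      and e'_height: "\<forall>s\<in>bar. e' (\<epsilon> s) \<in> supported {t \<in> bar. height t \<le> height s}"
      and e'_b: "\<forall>s\<in>bar. card s = b \<longrightarrow> e' (\<epsilon> s) \<in>
        supported {t \<in> bar. \<exists>y. \<not> acyclic_at TYPE('k) b y \<and> height t \<le> y \<and> y \<le> height s}"
    using deflation [where 'a = 'a and 'k = 'k, of b] by (elim exE conjE) (rule that)
  define E where "E = tensor_map e e'"
  have lin_E: "lin E" unfolding E_def by (rule lin_tensor_map)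
  have E_tensor: "E (tensor u v) = tensor (e u) (e' v)" for u v
    unfolding E_def by (rule tensor_map_tensor [OF lin_e lin_e'])
  \<comment> \<open>The sign in \<open>bd2\<close> passes through because \<open>e\<close> preserves
    degrees.\<close>
  have bd2_E: "bd2 (E w) = E (bd2 w)" for w
    by (rule lin_eq_on_tensors [OF lin_comp [OF lin_bd2 lin_E] lin_comp [OF lin_E lin_bd2]])
      (simp add: E_tensor bd2_tensor lin_add [OF lin_E] e_bd e'_bd
        parity_commute [OF lin_e e_card [rule_format]])
  have E_natural: "E (\<epsilon> p) \<in> supported {q \<in> bar \<times> bar. height2 q \<le> height2 p}"
    if p_bar: "p \<in> bar \<times> bar" for p
  proof -
    obtain s t where p: "p = (s, t)" "s \<in> bar" "t \<in> bar" using p_bar by auto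
    have "E (\<epsilon> p) \<in> supported ({s' \<in> bar. height s' \<le> height s} \<times> {t' \<in> bar. height t' \<le> height t})"
      unfolding p(1) tensor_unit_vec [symmetric] E_tensor
      using p e_height e'_height by (intro tensor_supported) auto
    then show ?thesis
      by (rule subsetD [OF supported_mono, rotated]) (auto simp: p intro: le_supI1 le_supI2)
  qed

  define i1 :: "'k ^ ('a set) \<Rightarrow> 'k ^ ('a set \<times> 'a set)" where "i1 v = tensor v (\<epsilon> {})" for v
  define i2 :: "'k ^ ('a set) \<Rightarrow> 'k ^ ('a set \<times> 'a set)" where "i2 v = tensor (\<epsilon> {}) v" for v
  have lin_i1: "lin i1" and lin_i2: "lin i2"
    unfolding i1_def i2_def by (rule lin_tensor_left lin_tensor_right)+
  have bd2_i1: "bd2 (i1 v) = i1 (bd v)" for v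
    by (simp add: i1_def bd2_tensor bd_empty tensor_zero_right)
  have bd2_i2: "bd2 (i2 v) = i2 (bd v)" for v
    by (simp add: i2_def bd2_tensor bd_empty tensor_zero_left parity_unit_vec)
  have "FT.chain_map i1"
    by (rule FT.chain_mapI) (simp_all add: FT.natural_def lin_i1 bd2_i1, simp_all add: i1_def tensor_unit_vec)
  moreover have "FT.chain_map i2"
    by (rule FT.chain_mapI) (simp_all add: FT.natural_def lin_i2 bd2_i2, simp_all add: i2_def tensor_unit_vec)
  ultimately obtain k where k: "FT.natural k" "\<forall>v\<in>supported bar. i1 v - i2 v = bd2 (k v) + k (bd v)"
    using FT.homotopy_exists by blast
  obtain r where r: "TF.chain_map r"
    using TF.chain_map_exists by blast
  have r_natural: "TF.natural r" and r_base: "r (\<epsilon> ({}, {})) = \<epsilon> {}"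
    and bd_r: "\<forall>w\<in>supported (bar \<times> bar). bd (r w) = r (bd2 w)"
    using r by (simp_all add: TF.chain_map_def)
  have lin_r: "lin r" by (rule TF.naturalD(1) [OF r_natural])

  \<comment> \<open>A natural chain endomorphism of F that fixes the base generator, hence homotopic
    to the identity.\<close>
  define \<rho> where "\<rho> v = r (E (i1 v))" for v
  have lin_\<rho>: "lin \<rho>"
    unfolding \<rho>_def by (rule lin_comp [OF lin_r lin_comp [OF lin_E lin_i1]])
  have E_i1: "E (i1 (\<epsilon> s)) \<in> supported {q \<in> bar \<times> bar. height2 q \<le> height s}" if "s \<in> bar" for s
    using E_natural [of "(s, {})"] that by (simp add: i1_def tensor_unit_vec)
  have "FF.chain_map \<rho>"
  proof (rule FF.chain_mapI)
    show "FF.natural \<rho>"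
      unfolding FF.natural_def \<rho>_def [symmetric]
    proof (intro conjI ballI lin_\<rho>)
      show "\<rho> (\<epsilon> s) \<in> supported {t \<in> bar. height t \<le> height s}" if "s \<in> bar" for s
        unfolding \<rho>_def by (rule TF.naturalD(2) [OF r_natural E_i1 [OF that]])
    qed
    show "\<rho> (\<epsilon> {}) = \<epsilon> {}"
      by (simp add: \<rho>_def i1_def E_tensor e_empty e'_empty) (simp add: tensor_unit_vec r_base)
    show "bd (\<rho> (\<epsilon> s)) = \<rho> (bd (\<epsilon> s))" if "s \<in> bar" for s
    proof -
      have "E (i1 (\<epsilon> s)) \<in> supported (bar \<times> bar)"
        by (rule subsetD [OF supported_mono E_i1 [OF that]]) auto
      then show ?thesis
        using bd_r by (simp add: \<rho>_def bd2_E bd2_i1)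
    qed
  qed
  moreover have "FF.chain_map (\<lambda>v. v)"
    by (rule FF.chain_mapI) (simp_all add: FF.natural_def lin_ident)
  ultimately obtain l where l: "FF.natural l"
    "\<forall>v\<in>supported bar. \<rho> v - v = bd (l v) + l (bd v)"
    using FF.homotopy_exists by blast

  have c_bar: "c \<in> supported bar"
    using c by (auto simp: supported_def)
  have c_le: "c \<in> supported {s \<in> bar. height s \<le> m}"
    using c by (auto simp: supported_def)
  \<comment> \<open>Pairs whose first degree exceeds \<open>a\<close>, in total degree a + b + 1 for
    \<open>Q\<close> and a + b for \<open>Q'\<close>. Projecting to \<open>Q\<close> also selects
    the total degree, since naturality of \<open>k\<close> says nothing about degrees.\<close>
  define Q where "Q = {(s :: 'a set, t :: 'a set). a < card s \<and> card s + card t = Suc (a + b)}"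
  define Q' where "Q' = {(s :: 'a set, t :: 'a set). a < card s \<and> card s + card t = a + b}"
  define w where "w = k c"
  define u where "u = proj Q w"
  have w: "w \<in> supported Tle"
    using FT.naturalD(2) [OF k(1) c_le] by (simp add: w_def Tle_def)
  have k_bd_c: "k (bd c) \<in> supported Tlt"
    using FT.naturalD(3) [OF k(1) bd_c] by (simp add: Tlt_def)
  have u: "u \<in> supported (Q \<inter> Tle)"
    unfolding u_def by (rule proj_supported [OF w])
  \<comment> \<open>Taking a face never raises the first degree, so a pair with a face in
    \<open>Q'\<close> belongs to \<open>Q\<close>.\<close>
  have "bd2 (w - u) \<in> supported (- Q')"
  proof (rule supported_image [OF lin_bd2])
    show "w - u \<in> supported (Tle - Q)"
      using w by (auto simp: u_def supported_def proj_def)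
    fix p assume "p \<in> Tle - Q"
    then obtain s t where p: "p = (s, t)" "s \<in> bar" "t \<in> bar" "(s, t) \<notin> Q"
      by (auto simp: Tle_def)
    show "bd2 (\<epsilon> p) \<in> supported (- Q')"
      unfolding p(1) by (rule subsetD [OF supported_mono bd2_unit_vec_supported [OF p(2,3)]])
        (use p(4) in \<open>auto simp: Q_def Q'_def\<close>)
  qed
  then have "proj Q' (bd2 w) = proj Q' (bd2 u)"
    using proj_eq_0 [of "bd2 (w - u)" Q'] by (simp add: lin_diff [OF lin_bd2] lin_diff [OF lin_proj])
  \<comment> \<open>The bidegree of \<open>i1 c\<close> is (a + b, 0), inside \<open>Q'\<close>
    because b > 0; that of \<open>i2 c\<close> is (0, a + b), outside \<open>Q'\<close>.\<close>
  moreover have "proj Q' (i1 c) = i1 c"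
  proof (rule proj_ident)
    have "i1 c \<in> supported ({s \<in> bar. card s = a + b \<and> height s \<le> m} \<times> {{}})"
      unfolding i1_def by (rule tensor_supported [OF c]) simp
    then show "i1 c \<in> supported Q'"
      by (rule subsetD [OF supported_mono, rotated]) (use ab in \<open>auto simp: Q'_def\<close>)
  qed
  moreover have "proj Q' (i2 c) = 0"
  proof (rule proj_eq_0)
    have "i2 c \<in> supported ({{}} \<times> {s \<in> bar. card s = a + b \<and> height s \<le> m})"
      unfolding i2_def by (rule tensor_supported [OF _ c]) simp
    then show "i2 c \<in> supported (- Q')"
      by (rule subsetD [OF supported_mono, rotated]) (auto simp: Q'_def)
  qed
  moreover have "i1 c - i2 c = bd2 w + k (bd c)"
    using k(2) c_bar by (simp add: w_def)
  then have "proj Q' (i1 c) - proj Q' (i2 c) = proj Q' (bd2 w) + proj Q' (k (bd c))"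
    by (metis lin_diff [OF lin_proj] lin_add [OF lin_proj])
  ultimately have proj_u: "proj Q' (bd2 u) = i1 c - proj Q' (k (bd c))"
    by (simp add: algebra_simps)

  define y where "y = bd2 u - proj Q' (bd2 u)"
  define z where "z = proj Q' (k (bd c))"
  have bd2_u: "bd2 u = i1 c - z + y"
    by (simp add: y_def z_def proj_u)
  have z: "z \<in> supported Tlt"
    unfolding z_def using proj_supported [OF k_bd_c, of Q'] by (auto simp: supported_def)
  \<comment> \<open>Faces of pairs in \<open>Q\<close> have first degree at least \<open>a\<close>
    and total degree a + b; those outside \<open>Q'\<close> have bidegree exactly (a, b).\<close>
  have y: "y \<in> supported {(s, t). (s, t) \<in> Tle \<and> card s = a \<and> card t = b}"
  proof -
    have "bd2 u \<in> supported {(s, t). (s, t) \<in> Tle \<and> a \<le> card s \<and> card s + card t = a + b}"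
    proof (rule supported_image [OF lin_bd2 u])
      fix p assume "p \<in> Q \<inter> Tle"
      then obtain s t where p: "p = (s, t)" "s \<in> bar" "t \<in> bar" "(s, t) \<in> Q" "sup (height s) (height t) \<le> m"
        by (auto simp: Tle_def)
      show "bd2 (\<epsilon> p) \<in> supported {(s, t). (s, t) \<in> Tle \<and> a \<le> card s \<and> card s + card t = a + b}"
        unfolding p(1) by (rule subsetD [OF supported_mono bd2_unit_vec_supported [OF p(2,3)]])
          (use p in \<open>auto simp: Q_def Tle_def intro: order_trans\<close>)
    qed
    then have "(s, t) \<in> Tle \<and> card s = a \<and> card t = b" if y_st: "y $ (s, t) \<noteq> 0" for s t
    proof -
      have "bd2 u $ (s, t) \<noteq> 0" "(s, t) \<notin> Q'"
        using y_st by (auto simp: y_def proj_def split: if_splits)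
      with \<open>bd2 u \<in> _\<close> have "(s, t) \<in> Tle" "a \<le> card s" "card s + card t = a + b" "(s, t) \<notin> Q'"
        by (auto simp: supported_def)
      then show ?thesis
        by (auto simp: Q'_def)
    qed
    then show ?thesis
      by (auto simp: supported_def)
  qed
  have E_y: "E y \<in> supported Tlt"
  proof (rule supported_image [OF lin_E y])
    fix p assume "p \<in> {(s, t). (s, t) \<in> Tle \<and> card s = a \<and> card t = b}"
    then obtain s t where p: "p = (s, t)" "s \<in> bar" "t \<in> bar" "card s = a" "card t = b"
      "height s \<le> m" "height t \<le> m"
      by (auto simp: Tle_def)
    let ?A = "{s' \<in> bar. \<exists>y. \<not> acyclic_at TYPE('k) a y \<and> height s' \<le> y \<and> y \<le> height s}"
    let ?B = "{t' \<in> bar. \<exists>y. \<not> acyclic_at TYPE('k) b y \<and> height t' \<le> y \<and> y \<le> height t}"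
    have "E (\<epsilon> p) \<in> supported (?A \<times> ?B)"
      unfolding p(1) tensor_unit_vec [symmetric] E_tensor
      using p e_a e'_b by (intro tensor_supported) auto
    moreover have "?A \<times> ?B \<subseteq> Tlt"
    \<comment> \<open>The two factors end up under positions x and y that are not acyclic. Their
      join is at most \<open>m\<close>, and by \<open>join\<close> it is not
      \<open>m\<close>.\<close>
    proof clarify
      fix s' t' x y assume st: "s' \<in> bar" "t' \<in> bar"
        and xy: "\<not> acyclic_at TYPE('k) a x" "\<not> acyclic_at TYPE('k) b y"
        and le: "height s' \<le> x" "x \<le> height s" "height t' \<le> y" "y \<le> height t"
      have "sup (height s') (height t') \<le> sup x y" using le by (intro sup_mono)
      also have "sup x y \<le> m" using le p by (meson le_supI order_trans)
      then have "sup x y < m" using join xy by (auto simp: less_le)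
      finally show "(s', t') \<in> Tlt"
        using st by (simp add: Tlt_def)
    qed
    ultimately show "E (\<epsilon> p) \<in> supported Tlt"
      using supported_mono by blast
  qed
  have E_z: "E z \<in> supported Tlt"
    unfolding Tlt_def
    by (rule natural_strictly_below [OF lin_E E_natural z [unfolded Tlt_def]])
  have r_Tlt: "r v \<in> supported {s \<in> bar. height s < m}" if "v \<in> supported Tlt" for v
    using TF.naturalD(3) [OF r_natural] that by (simp add: Tlt_def)
  have E_u: "E u \<in> supported (bar \<times> bar)"
  proof (rule supported_image [OF lin_E u])
    fix p assume "p \<in> Q \<inter> Tle"
    then show "E (\<epsilon> p) \<in> supported (bar \<times> bar)"
      by (intro subsetD [OF supported_mono E_natural]) (auto simp: Tle_def)
  qed

  \<comment> \<open>Apply \<open>r \<circ> E\<close> to \<open>i1 c = bd2 u + z - y\<close> and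
    replace \<open>\<rho> c\<close> by \<open>c\<close> through the homotopy \<open>l\<close>; the
    terms that are boundaries add up to \<open>bd g\<close>.\<close>
  define g where "g = r (E u) - l c"
  have "\<rho> c = r (E (bd2 u)) + r (E z) - r (E y)"
    by (simp add: \<rho>_def bd2_u lin_add [OF lin_E] lin_diff [OF lin_E] lin_add [OF lin_r] lin_diff [OF lin_r])
  moreover have "r (E (bd2 u)) = bd (r (E u))"
    using bd_r E_u by (simp add: bd2_E)
  moreover have "\<rho> c - c = bd (l c) + l (bd c)"
    using l(2) c_bar by blast
  ultimately have "c - bd g = r (E z) - r (E y) - l (bd c)"
    by (simp add: g_def lin_diff [OF lin_bd] algebra_simps)
  moreover have "l (bd c) \<in> supported {s \<in> bar. height s < m}"
    by (rule FF.naturalD(3) [OF l(1) bd_c])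
  ultimately have g: "c - bd g \<in> supported {s \<in> bar. height s < m}"
    by (simp add: supported_diff r_Tlt E_y E_z)
  have g_le: "g \<in> supported {s \<in> bar. height s \<le> m}"
    unfolding g_def
  proof (rule supported_diff)
    have "E u \<in> supported {q \<in> bar \<times> bar. height2 q \<le> m}"
      by (rule natural_below [OF lin_E E_natural]) (use u in \<open>auto simp: Tle_def supported_def\<close>)
    then show "r (E u) \<in> supported {s \<in> bar. height s \<le> m}"
      by (rule TF.naturalD(2) [OF r_natural])
    show "l c \<in> supported {s \<in> bar. height s \<le> m}"
      by (rule FF.naturalD(2) [OF l(1) c_le])
  qed
  \<comment> \<open>Neither \<open>r\<close> nor \<open>l\<close> is known to respect degrees, so
    \<open>g\<close> is cut down to degree a + b + 1.\<close>
  have "bd (proj {s. card s = Suc (a + b)} g) = proj {s. card s = a + b} (bd g)"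
    by (rule bd_proj_card) (use g_le in \<open>auto simp: supported_def\<close>)
  moreover have "proj {s. card s = a + b} c = c"
    by (rule proj_ident) (use c in \<open>auto simp: supported_def\<close>)
  ultimately have "c - bd (proj {s. card s = Suc (a + b)} g) = proj {s. card s = a + b} (c - bd g)"
    by (simp add: lin_diff [OF lin_proj])
  then have "c - bd (proj {s. card s = Suc (a + b)} g) \<in> supported {s \<in> bar. height s < m}"
    using proj_supported [OF g, of "{s. card s = a + b}"] by (auto simp: supported_def)
  moreover have "proj {s. card s = Suc (a + b)} g \<in> supported {s \<in> bar. card s = Suc (a + b) \<and> height s \<le> m}"
    using proj_supported [OF g_le, of "{s. card s = Suc (a + b)}"] by (auto simp: supported_def)
  ultimately show "\<exists>e\<in>supported {s \<in> bar. card s = Suc (a + b) \<and> height s \<le> m}.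
      c - bd e \<in> supported {s \<in> bar. height s < m}"
    by blast
qed

section \<open>Comparison with the homology of open intervals\<close>

text \<open>Removing the top element $x$ identifies the chains with top $x$ with the chains of
  $(\hat 0, x)$, shifting the dimension by one.\<close>

definition strip :: "'a::finite \<Rightarrow> 'k::field ^ ('a set) \<Rightarrow> 'k ^ ('a set)" where
  "strip x v = (\<chi> t. if x \<in> t then 0 else v $ insert x t)"

definition attach :: "'a::finite \<Rightarrow> 'k::field ^ ('a set) \<Rightarrow> 'k ^ ('a set)" where
  "attach x u = (\<chi> s. if x \<in> s then u $ (s - {x}) else 0)"

lemma lin_strip: "lin (strip x)"
  by (simp add: lin_iff strip_def vec_eq_iff)

lemma strip_unit_vec: "strip x (\<epsilon> s) = (if x \<in> s then \<epsilon> (s - {x}) else 0)"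
  by (auto simp: strip_def axis_def vec_eq_iff)

lemma strip_attach:
  assumes "u \<in> supported {t. x \<notin> t}"
  shows "strip x (attach x u) = u"
  using assms by (auto simp: strip_def attach_def vec_eq_iff supported_def)

text \<open>Since \<open>x\<close> is the top, deleting it changes no sign of the other faces, and
  the face omitting \<open>x\<close> is killed by \<open>strip x\<close>.\<close>

lemma strip_bd:
  assumes "v \<in> supported {s \<in> bar. height s \<le> x}"
  shows "strip x (bd v) = bd (strip x (v :: 'k::field ^ ('a::{finite, bounded_lattice_bot} set)))"
proof (rule lin_eq_on_supported [OF lin_comp [OF lin_strip lin_bd] lin_comp [OF lin_bd lin_strip] assms])
  fix s :: "'a set" assume "s \<in> {s \<in> bar. height s \<le> x}"
  then have s: "s \<in> bar" "\<And>y. y \<in> s \<Longrightarrow> y \<le> x" by (auto simp: height_le_iff)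
  have face: "s - {x} \<in> bar" using s(1) by (rule bar_mono) auto
  have strip: "strip x (bd (\<epsilon> s)) = (\<Sum>z\<in>s. (sgn_pos s z :: 'k) *s strip x (\<epsilon> (s - {z})))"
    by (simp add: bd_unit_vec s(1) lin_sum [OF lin_strip] lin_scale [OF lin_strip])
  show "strip x (bd (\<epsilon> s)) = bd (strip x (\<epsilon> s) :: 'k ^ _)"
  proof (cases "x \<in> s")
    case True
    have "(\<Sum>z\<in>s. (sgn_pos s z :: 'k) *s strip x (\<epsilon> (s - {z}))) =
        (\<Sum>z\<in>s - {x}. (sgn_pos s z :: 'k) *s strip x (\<epsilon> (s - {z})))"
      by (rule sum.mono_neutral_right) (auto simp: strip_unit_vec)
    also have "\<dots> = (\<Sum>z\<in>s - {x}. (sgn_pos (s - {x}) z :: 'k) *s \<epsilon> (s - {x} - {z}))"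
    proof (rule sum.cong [OF refl])
      fix z assume z: "z \<in> s - {x}"
      then have "{y \<in> s - {x}. y < z} = {y \<in> s. y < z}" "s - {z} - {x} = s - {x} - {z}"
        using s(2) [of z] by auto
      with z True show "(sgn_pos s z :: 'k) *s strip x (\<epsilon> (s - {z})) = sgn_pos (s - {x}) z *s \<epsilon> (s - {x} - {z})"
        by (auto simp: strip_unit_vec sgn_pos_def)
    qed
    also have "\<dots> = bd (\<epsilon> (s - {x}))"
      by (simp add: bd_unit_vec face)
    finally show ?thesis
      using True by (simp add: strip strip_unit_vec)
  next
    case False
    then show ?thesis by (simp add: strip strip_unit_vec lin_zero [OF lin_bd])
  qed
qed

text \<open>The height of a nonempty chain is attained; x \<noteq> \<open>bot\<close> handles the
  empty chain, which sits at \<open>bot\<close> without containing it.\<close>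

lemma height_less_iff:
  assumes "s \<in> bar" "height s \<le> x" "x \<noteq> bot"
  shows "height s < x \<longleftrightarrow> x \<notin> s"
proof
  show "x \<notin> s" if "height s < x"
    using that height_upper [of x s] by (auto dest: leD)
  show "height s < x" if "x \<notin> s"
  proof -
    have "height s \<noteq> x"
      using that assms height_in [of s] by (cases "s = {}") auto
    then show ?thesis using assms by (simp add: less_le)
  qed
qed

text \<open>Thus \<open>strip x\<close> realizes the quotient of F(x) by its part strictly below
  \<open>x\<close>.\<close>

lemma strip_eq_0_iff:
  assumes "v \<in> supported {s \<in> bar. height s \<le> x}" "x \<noteq> bot"
  shows "strip x v = 0 \<longleftrightarrow> v \<in> supported {s \<in> bar. height s < x}"
proof
  assume z: "strip x v = 0"
  have "x \<notin> s" if "v $ s \<noteq> 0" for s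
  proof
    assume "x \<in> s"
    then have "strip x v $ (s - {x}) = v $ s"
      by (simp add: strip_def insert_absorb)
    with z that show False by simp
  qed
  with assms show "v \<in> supported {s \<in> bar. height s < x}"
    by (auto simp: supported_def height_less_iff)
next
  assume v: "v \<in> supported {s \<in> bar. height s < x}"
  have "v $ insert x t = 0" for t
  proof (rule supportedD [OF v], rule notI)
    assume "insert x t \<in> {s \<in> bar. height s < x}"
    then show False
      using height_upper [of x "insert x t"] by (auto dest: leD)
  qed
  then show "strip x v = 0"
    by (simp add: strip_def vec_eq_iff)
qed

lemma simplices_open_interval:
  "simplices {bot<..<x} (int n - 1) = {t \<in> bar. card t = n \<and> (\<forall>y\<in>t. y < x)}"
  by (auto simp: simplices_def bar_def order_complex_def)

section \<open>Homology of open intervals in terms of \<open>bd\<close>\<close>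

lemma lookup_to_vec: "to_vec c $ s = Poly_Mapping.lookup c s"
  by (simp add: to_vec_def)

lemma to_vec_surj: "\<exists>c. to_vec c = v"
proof
  show "to_vec (\<Sum>s\<in>UNIV. Poly_Mapping.single s (v $ s)) = v"
    by (simp add: to_vec_sum to_vec_single basis_expansion)
qed

lemma to_vec_eq_iff: "to_vec c = to_vec e \<longleftrightarrow> c = e"
  by (simp add: vec_eq_iff lookup_to_vec poly_mapping_eq_iff fun_eq_iff)

lemma chain_space_iff: "c \<in> chain_space K P k \<longleftrightarrow> to_vec c \<in> supported (simplices P k)"
  by (auto simp: chain_space_def supported_def lookup_to_vec in_keys_iff)

lemma trivial_reduced_homology_open_interval:
  fixes x :: "'a::{finite, bounded_lattice_bot}"
  defines "K \<equiv> \<lambda>n. {t \<in> bar. card t = n \<and> (\<forall>y\<in>t. y < x)}"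
  shows "trivial_group (reduced_homology TYPE('k::field) (int n - 1) {bot<..<x}) \<longleftrightarrow>
    (\<forall>u :: 'k ^ ('a set) \<in> supported (K n). bd u = 0 \<longrightarrow> (\<exists>w\<in>supported (K (Suc n)). bd w = u))"
proof -
  have K: "simplices {bot<..<x} (int n - 1) = K n" "simplices {bot<..<x} (int n) = K (Suc n)"
    using simplices_open_interval [of x n] simplices_open_interval [of x "Suc n"] by (simp_all add: K_def)
  have bd: "bd (to_vec c) = to_vec (boundary c)" if "to_vec c \<in> supported (K j)" for c :: "'a set \<Rightarrow>\<^sub>0 'k" and j
    using that by (intro bd_to_vec) (auto simp: K_def supported_def lookup_to_vec in_keys_iff)
  have cyc: "c \<in> cycles TYPE('k) {bot<..<x} (int n - 1) \<longleftrightarrow> to_vec c \<in> supported (K n) \<and> bd (to_vec c) = 0" for c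
    using bd [of c n] to_vec_eq_iff [of "boundary c" 0] by (auto simp: cycles_def chain_space_iff K)
  have bdry: "c \<in> boundaries TYPE('k) {bot<..<x} (int n - 1) \<longleftrightarrow> (\<exists>w\<in>supported (K (Suc n)). bd w = to_vec c)" for c
  proof
    assume "c \<in> boundaries TYPE('k) {bot<..<x} (int n - 1)"
    then obtain e where "e \<in> chain_space TYPE('k) {bot<..<x} (int n)" "c = boundary e"
      by (auto simp: boundaries_def)
    then show "\<exists>w\<in>supported (K (Suc n)). bd w = to_vec c"
      using bd [of e] by (auto simp: chain_space_iff K)
  next
    assume "\<exists>w\<in>supported (K (Suc n)). bd w = to_vec c"
    then obtain w where w: "w \<in> supported (K (Suc n))" "bd w = to_vec c" ..
    obtain e where e: "to_vec e = w" using to_vec_surj by blast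
    with w bd [of e] have "c = boundary e" by (simp add: to_vec_eq_iff)
    moreover have "e \<in> chain_space TYPE('k) {bot<..<x} (int n)"
      using w e by (simp add: chain_space_iff K)
    ultimately show "c \<in> boundaries TYPE('k) {bot<..<x} (int n - 1)"
      by (simp add: boundaries_def)
  qed
  show ?thesis
    unfolding trivial_reduced_homology_iff
  proof (intro iffI ballI impI subsetI)
    fix u :: "'k ^ ('a set)"
    assume sub: "cycles TYPE('k) {bot<..<x} (int n - 1) \<subseteq> boundaries TYPE('k) {bot<..<x} (int n - 1)"
      and u: "u \<in> supported (K n)" "bd u = 0"
    obtain c where "to_vec c = u" using to_vec_surj by blast
    with sub u show "\<exists>w\<in>supported (K (Suc n)). bd w = u"
      using cyc bdry by blast
  qed (use cyc bdry in blast)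
qed

text \<open>\<open>strip x\<close>, with right inverse \<open>attach x\<close>, carries the quotient
  complex at \<open>x\<close> to the chain complex of the open interval. Degree n + 1 goes to chains
  with n elements, which are simplices of dimension n - 1.\<close>

lemma acyclic_at_iff:
  fixes x :: "'a::{finite, bounded_lattice_bot}"
  assumes x: "x \<noteq> bot"
  shows "acyclic_at TYPE('k::field) (Suc n) x \<longleftrightarrow>
    trivial_group (reduced_homology TYPE('k) (int n - 1) {bot<..<x})"
proof -
  define K where "K n = {t \<in> bar. card t = n \<and> (\<forall>y\<in>t. y < x)}" for n
  define C where "C n = {s \<in> bar. card s = n \<and> height s \<le> x}" for n
  have strip_C: "strip x v \<in> supported (K n)" if v: "v \<in> supported (C (Suc n))" for v :: "'k ^ ('a set)" and n
  proof (rule supported_image [OF lin_strip v])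
    fix s assume s: "s \<in> C (Suc n)"
    show "strip x (\<epsilon> s) \<in> supported (K n)"
      using s by (auto simp: strip_unit_vec C_def K_def height_le_iff less_le intro: bar_mono)
  qed
  have attach_K: "attach x u \<in> supported (C (Suc n))" if u: "u \<in> supported (K n)"
    for u :: "'k ^ ('a set)" and n
  proof -
    have "s \<in> C (Suc n)" if s: "x \<in> s" "s - {x} \<in> K n" for s
    proof -
      have face: "s - {x} \<in> bar" using s by (simp add: K_def)
      have le: "y \<le> x" if "y \<in> s" for y
        using s that by (cases "y = x") (auto simp: K_def less_imp_le)
      have "card s = Suc n"
        using s card_Suc_Diff1 [of s x] by (simp add: K_def)
      moreover have "s \<in> bar"
        unfolding bar_iff
      proof (intro conjI ballI)
        show "bot \<notin> s"
          using face x by (auto simp: bar_iff)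
        show "y \<le> z \<or> z \<le> y" if "y \<in> s" "z \<in> s" for y z
          using that le face by (cases "y = x"; cases "z = x") (auto simp: bar_iff)
      qed
      ultimately show ?thesis by (simp add: C_def height_le_iff le)
    qed
    then show ?thesis
      using u by (auto simp: attach_def supported_def)
  qed
  have strip_attach_K: "strip x (attach x u) = u" if "u \<in> supported (K n)" for u :: "'k ^ ('a set)" and n
    using that by (intro strip_attach) (auto simp: supported_def K_def)
  have C_le: "v \<in> supported {s \<in> bar. height s \<le> x}" if "v \<in> supported (C n)"
    for v :: "'k ^ ('a set)" and n
    using that by (auto simp: C_def supported_def)
  have bd_le: "bd v \<in> supported {s \<in> bar. height s \<le> x}" if "v \<in> supported {s \<in> bar. height s \<le> x}"
    for v :: "'k ^ ('a set)"
    using that by (rule bd_supported) auto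
  have bd_less: "bd c \<in> supported {s \<in> bar. height s < x} \<longleftrightarrow> bd (strip x c) = 0"
    if "c \<in> supported (C j)" for c :: "'k ^ ('a set)" and j
    using strip_eq_0_iff [OF bd_le [OF C_le [OF that]] x] strip_bd [OF C_le [OF that]] by simp
  have diff_less: "c - bd e \<in> supported {s \<in> bar. height s < x} \<longleftrightarrow> strip x c = bd (strip x e)"
    if "c \<in> supported (C i)" "e \<in> supported (C j)" for c e :: "'k ^ ('a set)" and i j
    using strip_eq_0_iff [OF supported_diff [OF C_le [OF that(1)] bd_le [OF C_le [OF that(2)]]] x]
      strip_bd [OF C_le [OF that(2)]] by (simp add: lin_diff [OF lin_strip])
  have "acyclic_at TYPE('k) (Suc n) x \<longleftrightarrow>
    (\<forall>c :: 'k ^ ('a set) \<in> supported (C (Suc n)). bd (strip x c) = 0 \<longrightarrow>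
       (\<exists>e\<in>supported (C (Suc (Suc n))). strip x c = bd (strip x e)))"
    unfolding acyclic_at_def C_def [symmetric]
  proof (rule ball_cong [OF refl])
    fix c :: "'k ^ ('a set)" assume c: "c \<in> supported (C (Suc n))"
    have "(\<exists>e\<in>supported (C (Suc (Suc n))). c - bd e \<in> supported {s \<in> bar. height s < x}) \<longleftrightarrow>
        (\<exists>e\<in>supported (C (Suc (Suc n))). strip x c = bd (strip x e))"
      by (rule bex_cong [OF refl]) (rule diff_less [OF c])
    then show "(bd c \<in> supported {s \<in> bar. height s < x} \<longrightarrow>
        (\<exists>e\<in>supported (C (Suc (Suc n))). c - bd e \<in> supported {s \<in> bar. height s < x})) \<longleftrightarrow>
      (bd (strip x c) = 0 \<longrightarrow> (\<exists>e\<in>supported (C (Suc (Suc n))). strip x c = bd (strip x e)))"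
      using bd_less [OF c] by simp
  qed
  also have "\<dots> \<longleftrightarrow>
    (\<forall>u :: 'k ^ ('a set) \<in> supported (K n). bd u = 0 \<longrightarrow> (\<exists>w\<in>supported (K (Suc n)). bd w = u))"
  proof (intro iffI ballI impI)
    fix u :: "'k ^ ('a set)"
    assume ac: "\<forall>c :: 'k ^ ('a set) \<in> supported (C (Suc n)). bd (strip x c) = 0 \<longrightarrow>
       (\<exists>e\<in>supported (C (Suc (Suc n))). strip x c = bd (strip x e))"
      and u: "u \<in> supported (K n)" "bd u = 0"
    obtain e where "e \<in> supported (C (Suc (Suc n)))" "u = bd (strip x e)"
      using bspec [OF ac attach_K [OF u(1)]] u(2) strip_attach_K [OF u(1)] by auto
    then show "\<exists>w\<in>supported (K (Suc n)). bd w = u"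
      using strip_C [of e "Suc n"] by blast
  next
    fix c :: "'k ^ ('a set)"
    assume ac: "\<forall>u :: 'k ^ ('a set) \<in> supported (K n). bd u = 0 \<longrightarrow>
        (\<exists>w\<in>supported (K (Suc n)). bd w = u)"
      and c: "c \<in> supported (C (Suc n))" "bd (strip x c) = 0"
    obtain w where w: "w \<in> supported (K (Suc n))" "bd w = strip x c"
      using bspec [OF ac strip_C [OF c(1)]] c(2) by auto
    then show "\<exists>e\<in>supported (C (Suc (Suc n))). strip x c = bd (strip x e)"
      using attach_K [OF w(1)] strip_attach_K [OF w(1)] by metis
  qed
  finally show ?thesis
    unfolding trivial_reduced_homology_open_interval K_def .
qed

theorem theorem1p2:
  fixes i1 i2 :: int and m :: "'a::{finite, bounded_lattice_bot}"
  assumes "i1 \<ge> 1" and "i2 \<ge> 1"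
    and "\<not> trivial_group (reduced_homology TYPE('k::field) (i1 + i2 - 2) {bot<..<m})"
  shows "\<exists>n1 n2 :: 'a.
           \<not> trivial_group (reduced_homology TYPE('k) (i1 - 2) {bot<..<n1}) \<and>
           \<not> trivial_group (reduced_homology TYPE('k) (i2 - 2) {bot<..<n2}) \<and>
           sup n1 n2 = m"
proof (rule ccontr)
  assume contra: "\<not> ?thesis"
  \<comment> \<open>The resolution degrees are \<open>Suc a\<close> = i1 and \<open>Suc b\<close> =
    i2; \<open>acyclic_at_iff\<close> turns degree i into homology in dimension i - 2.\<close>
  define a b where "a = nat (i1 - 1)" and "b = nat (i2 - 1)"
  have ab: "i1 = int (Suc a)" "i2 = int (Suc b)"
    using assms(1,2) by (simp_all add: a_def b_def)
  have deg: "i1 - 2 = int a - 1" "i2 - 2 = int b - 1" "i1 + i2 - 2 = int (Suc (a + b)) - 1"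
    using ab by simp_all
  have acyclic: "acyclic_at TYPE('k) (Suc n) x"
    if "trivial_group (reduced_homology TYPE('k) (int n - 1) {bot<..<x})" for n and x :: 'a
  proof (cases "x = bot")
    case True
    \<comment> \<open>The value at \<open>bot\<close> is concentrated in degree 0, so every positive
      degree is acyclic there.\<close>
    have empty: "{s \<in> bar. card s = Suc n \<and> height s \<le> x} = {}"
      by (auto simp: True bot_unique height_eq_bot_iff)
    show ?thesis
      unfolding acyclic_at_def empty supported_empty
      by (auto simp: lin_zero [OF lin_bd] intro!: bexI [of _ 0])
  next
    case False
    with that show ?thesis by (simp add: acyclic_at_iff)
  qed
  have "acyclic_at TYPE('k) (Suc a + Suc b) m"
  proof (rule acyclic_at_join)
    fix x y :: 'a assume "sup x y = m"
    with contra deg show "acyclic_at TYPE('k) (Suc a) x \<or> acyclic_at TYPE('k) (Suc b) y"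
      by (metis acyclic)
  qed simp_all
  then have "trivial_group (reduced_homology TYPE('k) (int (Suc (a + b)) - 1) {bot<..<m})"
    if "m \<noteq> bot"
    using acyclic_at_iff [where 'k = 'k, OF that, of "Suc (a + b)"] by simp
  \<comment> \<open>Outside the scope of \<open>acyclic_at_iff\<close>: the interval is empty, so it
    has no simplices in the dimension a + b \<ge> 0.\<close>
  moreover have "trivial_group (reduced_homology TYPE('k) (int (Suc (a + b)) - 1) {bot<..<m})"
    if "m = bot"
  proof -
    have empty: "{t \<in> bar. card t = Suc (a + b) \<and> (\<forall>y\<in>t. y < m)} = {}"
      by (auto simp: that)
    show ?thesis
      unfolding trivial_reduced_homology_open_interval empty supported_empty
      by (auto simp: lin_zero [OF lin_bd] intro!: bexI [of _ 0])
  qed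
  ultimately show False
    using assms(3) deg by metis
qed

end
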